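(* For every integer $g\ge 3$ there is a polynomial $h(\delta,g)$ in $\delta$, of degree $\lfloor \frac{g-1}{2}\rfloor$, such that for every $\varepsilon>0$ there is a constant $c$ (depending only on $g$ and $\varepsilon$) for which the following holds: for every connected bridgeless graph $G=(V,E)$ of order $n$, minimum degree $\delta$ and girth $g$, $$\overrightarrow{\mathrm{diam}}(G)\leq (2g+\varepsilon)\,\frac{n}{h(\delta,g)}+c .$$
   Context: All graphs are finite and simple. The order of a graph is its number of vertices; the girth is the length of its shortest cycle. A bridge of a connected graph is an edge whose removal disconnects the graph; a graph is bridgeless if it has no bridge. An orientation of $G$ is a digraph obtained by giving each edge of $G$ exactly one direction. The distance $\rho(u,v)$ in a digraph is the minimum number of arcs on a directed path from $u$ to $v$ ($\infty$ if there is none), and the diameter of a digraph is the maximum of $\rho(u,v)$ over all ordered pairs of vertices; the digraph is strongly connected if its diameter is finite. The oriented diameter $\overrightarrow{\mathrm{diam}}(G)$ is the minimum of the diameters of all strongly connected orientations of $G$ (one exists for every connected bridgeless graph). *)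

theory Defs
  imports "Graph_Theory.Graph_Theory" "HOL-Computational_Algebra.Polynomial"
    "HOL-Library.Extended_Nat"
begin

text \<open>
  A finite simple graph is a \<^locale>\<open>pair_graph\<close>: a finite, loop-free, symmetric digraph without
  parallel arcs, in which the undirected edge \<open>uv\<close> is the pair of arcs \<open>(u, v)\<close>, \<open>(v, u)\<close>.
\<close>

definition min_degree :: "'a pair_pre_digraph \<Rightarrow> nat" where
  "min_degree G = Min ((\<lambda>v. out_degree (with_proj G) v) ` pverts G)"

text \<open>
  In a symmetric digraph \<^const>\<open>pre_digraph.cycle\<close> also accepts \<open>u \<rightarrow> v \<rightarrow> u\<close>; the cycles of the
  undirected graph are those of length at least 3. The girth of an acyclic graph is \<open>\<infinity>\<close>.
\<close>

definition girth :: "'a pair_pre_digraph \<Rightarrow> enat" where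
  "girth G = (INF p\<in>{p. pre_digraph.cycle (with_proj G) p \<and> 3 \<le> length p}. enat (length p))"

definition delete_edge :: "'a pair_pre_digraph \<Rightarrow> 'a \<times> 'a \<Rightarrow> 'a pair_pre_digraph" where
  "delete_edge G e = G\<lparr>parcs := parcs G - {e, prod.swap e}\<rparr>"

definition bridge :: "'a pair_pre_digraph \<Rightarrow> 'a \<times> 'a \<Rightarrow> bool" where
  "bridge G e \<longleftrightarrow>
     e \<in> parcs G \<and> \<not> Digraph_Component.connected (with_proj (delete_edge G e))"

definition bridgeless :: "'a pair_pre_digraph \<Rightarrow> bool" where
  "bridgeless G \<longleftrightarrow> (\<nexists>e. bridge G e)"

definition orientation :: "'a pair_pre_digraph \<Rightarrow> 'a pair_pre_digraph \<Rightarrow> bool" where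
  "orientation D G \<longleftrightarrow> spanning (with_proj D) (with_proj G) \<and>
     (\<forall>(u, v)\<in>parcs G. ((u, v) \<in> parcs D) \<noteq> ((v, u) \<in> parcs D))"

definition digraph_dist :: "'a pair_pre_digraph \<Rightarrow> 'a \<Rightarrow> 'a \<Rightarrow> ereal" where
  "digraph_dist D u v = wf_digraph.\<mu> (with_proj D) (\<lambda>_. 1) u v"

definition digraph_diameter :: "'a pair_pre_digraph \<Rightarrow> ereal" where
  "digraph_diameter D = (SUP (u, v)\<in>pverts D \<times> pverts D. digraph_dist D u v)"

text \<open>
  The infimum is taken in \<^typ>\<open>ereal\<close>, so a graph without a strongly connected orientation has
  oriented diameter \<open>\<infinity>\<close>; otherwise it is a minimum, as finite diameters are natural numbers.
\<close>

definition oriented_diameter :: "'a pair_pre_digraph \<Rightarrow> ereal" where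
  "oriented_diameter G =
     (INF D\<in>{D. orientation D G \<and> strongly_connected (with_proj D)}. digraph_diameter D)"

end

theory Submission
  imports Defs
begin

text \<open>
  Let \<open>k = (g - 1) div 2\<close>. The leading coefficient of \<open>h\<close> is unconstrained, so a bound of the form
  \<open>C n / \<delta>\<^sup>k + c\<close> with constants depending on \<open>g\<close> suffices. A maximal set \<open>S\<close> of vertices at pairwise
  distance more than \<open>2k\<close> has at most about \<open>n / (\<delta> - 1)\<^sup>k\<close> elements, because breadth-first search
  to depth \<open>k\<close> runs into no cycle. \<open>S\<close> lies in a connected subgraph with \<open>O(k |S|)\<close> edges. Every bridge of that subgraph can be
  bypassed by a path of length at most \<open>4k + 1\<close>, since all vertices are within \<open>2k\<close> of it; adding these
  paths yields a bridgeless connected subgraph with \<open>O(k\<^sup>2 |S|)\<close> edges. A strong orientation of it has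
  diameter at most its number of edges, and extends to the whole graph one BFS layer at a time,
  which costs a further additive constant depending only on \<open>k\<close>.
\<close>

section \<open>Walks as powers of relations\<close>

text \<open>A reflexive step is a pause, so \<open>(R\<^sup>=) ^^ n\<close> encodes walks of length
  at most \<open>n\<close>. Distance bounds are stated in this form below because it is monotone in
  both the relation and the length.\<close>

lemma relpow_reflcl_mono:
  assumes "(x, y) \<in> (R\<^sup>=) ^^ m" "R \<subseteq> S" "m \<le> n"
  shows "(x, y) \<in> (S\<^sup>=) ^^ n"
  using assms(3)
proof (induction rule: dec_induct)
  case base
  show ?case using assms(1,2) unfolding relpow_fun_conv by blast
next
  case (step n)
  then show ?case by auto
qed

lemma relpow_sym:
  assumes "sym R" "(x, y) \<in> R ^^ n"
  shows "(y, x) \<in> R ^^ n"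
  using assms(2)
proof (induction n arbitrary: y)
  case (Suc n)
  then obtain z where "(x, z) \<in> R ^^ n" "(z, y) \<in> R" by auto
  with Suc.IH assms(1) show ?case by (meson relpow_Suc_I2 symE)
qed simp

lemma sym_reflcl: "sym R \<Longrightarrow> sym (R\<^sup>=)"
  by (auto simp: sym_def)

lemma relpow_reflcl_rtrancl: "(x, y) \<in> (R\<^sup>=) ^^ n \<Longrightarrow> (x, y) \<in> R\<^sup>*"
  by (metis relpow_imp_rtrancl rtrancl_reflcl)

lemma rtrancl_leaves_set:
  assumes "(x, y) \<in> R\<^sup>*" "x \<in> A" "y \<notin> A"
  obtains u v where "(u, v) \<in> R" "u \<in> A" "v \<notin> A"
  using assms by (induction arbitrary: thesis rule: rtrancl_induct) blast+

text \<open>A maximal independent set \<open>I\<close> works: a vertex in \<open>I\<close> has only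
  neighbours outside \<open>I\<close>, and a vertex of \<open>V\<close> outside \<open>I\<close> has
  a neighbour in \<open>I\<close> by maximality.\<close>

lemma opposite_colouring:
  assumes "finite V" "sym Q" "irrefl Q"
  shows "\<exists>I. \<forall>(v, w)\<in>Q \<inter> V \<times> V. \<exists>u\<in>V. (v, u) \<in> Q \<and> (v \<in> I) \<noteq> (u \<in> I)"
proof -
  let ?\<I> = "{I. I \<subseteq> V \<and> Q \<inter> I \<times> I = {}}"
  have "finite ?\<I>" using assms(1) by simp
  moreover have "?\<I> \<noteq> {}" by blast
  ultimately have "\<exists>I\<in>?\<I>. \<forall>J\<in>?\<I>. I \<subseteq> J \<longrightarrow> I = J"
    by (rule finite_has_maximal)
  then obtain I where I: "I \<in> ?\<I>" and max: "\<forall>J\<in>?\<I>. I \<subseteq> J \<longrightarrow> I = J"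
    by (elim bexE)
  have "\<exists>u\<in>V. (v, u) \<in> Q \<and> (v \<in> I) \<noteq> (u \<in> I)" if vw: "v \<in> V" "w \<in> V" "(v, w) \<in> Q" for v w
  proof (cases "v \<in> I")
    case True
    with I vw show ?thesis by blast
  next
    case False
    have "insert v I \<notin> ?\<I>" using bspec[OF max, of "insert v I"] False by blast
    then obtain a b where ab: "(a, b) \<in> Q" "a \<in> insert v I" "b \<in> insert v I"
      using I vw(1) by blast
    moreover have "(b, a) \<in> Q" using assms(2) ab(1) by (rule symE)
    moreover have "(v, v) \<notin> Q" using assms(3) by (simp add: irrefl_def)
    ultimately obtain u where "u \<in> I" "(v, u) \<in> Q"
      using I by blast
    with False I show ?thesis by blast
  qed
  then show ?thesis by blast
qed

lemma rtrancl_sym: "sym R \<Longrightarrow> (x, y) \<in> R\<^sup>* \<Longrightarrow> (y, x) \<in> R\<^sup>*"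
  by (meson sym_rtrancl symE)

text \<open>A shortest walk repeats no arc, so \<open>card R\<close> bounds its length. The diameter
  of a strong orientation is later bounded by its number of arcs in this way.\<close>

lemma finite_rtrancl_relpow_reflcl:
  assumes "finite R" "(x, y) \<in> R\<^sup>*" "card R \<le> n"
  shows "(x, y) \<in> (R\<^sup>=) ^^ n"
proof -
  obtain m where m: "m \<le> card R" "(x, y) \<in> R ^^ m"
    using assms(2) unfolding rtrancl_finite_eq_relpow[OF assms(1)] by blast
  have "(x, y) \<in> (R\<^sup>=) ^^ m"
    using m(2) unfolding relpow_fun_conv by blast
  then show ?thesis
    by (rule relpow_reflcl_mono) (use m(1) assms(3) in simp_all)
qed

text \<open>\<open>F\<close> collects the arcs of the walk. Since each arc of \<open>F\<close> can
  be reached from \<open>x\<close> within \<open>F\<close>, a connected subgraph through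
  \<open>x\<close> stays connected when \<open>F\<close> is added to it.\<close>

lemma walk_arcs:
  assumes "(x, y) \<in> (R\<^sup>=) ^^ n"
  shows "\<exists>F\<subseteq>R. finite F \<and> card F \<le> n \<and> (x, y) \<in> F\<^sup>* \<and> (\<forall>(u, v)\<in>F. (x, u) \<in> F\<^sup>*)"
  using assms
proof (induction n arbitrary: y)
  case 0
  then show ?case by (intro exI[of _ "{}"]) simp
next
  case (Suc n)
  obtain z where z: "(x, z) \<in> (R\<^sup>=) ^^ n" "(z, y) \<in> R\<^sup>=" using Suc.prems by (rule relpow_Suc_E)
  obtain F where F: "F \<subseteq> R" "finite F" "card F \<le> n" "(x, z) \<in> F\<^sup>*" "\<forall>(u, v)\<in>F. (x, u) \<in> F\<^sup>*"
    using Suc.IH[OF z(1)] by (elim exE conjE)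
  show ?case
  proof (cases "z = y")
    case True
    then show ?thesis using F by (intro exI[of _ F]) simp
  next
    case False
    let ?F = "insert (z, y) F"
    have mono: "(u, v) \<in> ?F\<^sup>*" if "(u, v) \<in> F\<^sup>*" for u v
      using that rtrancl_mono[of F ?F] by blast
    have "(x, y) \<in> ?F\<^sup>*" using mono[OF F(4)] by (rule rtrancl_into_rtrancl) simp
    moreover have "\<forall>(u, v)\<in>?F. (x, u) \<in> ?F\<^sup>*" using F(4,5) mono by blast
    moreover have "card ?F \<le> Suc n" using F(2,3) by (simp add: card_insert_if)
    ultimately show ?thesis using F(1,2) z(2) False by (intro exI[of _ ?F]) simp
  qed
qed

text \<open>Cut the walk at its first and last use of the edge \<open>xy\<close>, if any. If the
  first use starts where the last one ends, the outer pieces join to a walk avoiding the edge;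
  otherwise they give one of the other two cases.\<close>

lemma rtrancl_split_arc:
  assumes "(a, b) \<in> R\<^sup>*"
  shows "let R' = R - {(x, y), (y, x)} in (a, b) \<in> R'\<^sup>* \<or>
    (a, x) \<in> R'\<^sup>* \<and> (y, b) \<in> R'\<^sup>* \<or> (a, y) \<in> R'\<^sup>* \<and> (x, b) \<in> R'\<^sup>*"
  using assms
proof (induction rule: rtrancl_induct)
  case base
  then show ?case by (simp add: Let_def)
next
  case (step c d)
  define R' where "R' = R - {(x, y), (y, x)}"
  consider "(c, d) \<in> R'" | "c = x" "d = y" | "c = y" "d = x"
    using step.hyps(2) by (auto simp: R'_def)
  then show ?case
    using step.IH unfolding R'_def[symmetric] Let_def
    by cases (blast intro: rtrancl_into_rtrancl)+
qed

lemma card_sym_closure: "finite F \<Longrightarrow> card (F \<union> F\<inverse>) \<le> 2 * card F"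
  using card_Un_le[of F "F\<inverse>"] by (simp add: card_inverse)

lemma relpow_reflclE:
  assumes "(x, y) \<in> (R\<^sup>=) ^^ n"
  obtains m where "m \<le> n" "(x, y) \<in> R ^^ m"
proof -
  have "\<exists>m\<le>n. (x, y) \<in> R ^^ m"
    using assms
  proof (induction n arbitrary: y)
    case (Suc n)
    obtain z where z: "(x, z) \<in> (R\<^sup>=) ^^ n" "(z, y) \<in> R\<^sup>=" using Suc.prems by (rule relpow_Suc_E)
    obtain m where m: "m \<le> n" "(x, z) \<in> R ^^ m" using Suc.IH[OF z(1)] by (elim exE conjE)
    show ?case
    proof (cases "z = y")
      case True
      then show ?thesis using m by (intro exI[of _ m]) simp
    next
      case False
      then have "(x, y) \<in> R ^^ Suc m" using z(2) relpow_Suc_I[OF m(2), of y] by blast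
      then show ?thesis using m(1) by (intro exI[of _ "Suc m"]) simp
    qed
  qed simp
  then show thesis using that by (elim exE conjE)
qed

section \<open>Extending an orientation layer by layer\<close>

text \<open>Bridgelessness is stated edge by edge, as a detour between the two ends that avoids the
  edge in both directions. The locale is instantiated with the whole graph and with a small subgraph
  of it.\<close>

locale bridgeless_graph =
  fixes V :: "'a set" and E :: "'a rel"
  assumes finite_V: "finite V"
    and E_subset: "E \<subseteq> V \<times> V"
    and sym_E: "sym E"
    and irrefl_E: "irrefl E"
    and no_bridge: "(x, y) \<in> E \<Longrightarrow> (x, y) \<in> (E - {(x, y), (y, x)})\<^sup>*"
begin

text \<open>One round of absorption, in which \<open>H\<close> grows by at least its neighbours. The
  length \<open>2 * r + 1\<close> counts an arc from \<open>H\<close> to a root, at most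
  \<open>r - 1\<close> steps in its cluster, an arc to a second cluster, at most
  \<open>r - 1\<close> steps to the root there, and an arc back to \<open>H\<close>.\<close>

lemma extend_layer:
  assumes D: "D \<subseteq> E \<inter> H \<times> H" "D \<inter> D\<inverse> = {}"
    and near: "\<forall>x\<in>V. \<exists>h\<in>H. (h, x) \<in> (E\<^sup>=) ^^ r"
    and "r > 0"
  shows "\<exists>H' D'. D \<subseteq> D' \<and> D' \<subseteq> E \<inter> H' \<times> H' \<and> D' \<inter> D'\<inverse> = {} \<and> H \<union> E `` H \<subseteq> H' \<and>
    (\<forall>x\<in>H'. (\<exists>h\<in>H. (h, x) \<in> (D'\<^sup>=) ^^ (2 * r + 1)) \<and>
      (\<exists>h\<in>H. (x, h) \<in> (D'\<^sup>=) ^^ (2 * r + 1)))"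
proof -

  \<comment> \<open>Breadth-first levels and clusters outside \<open>H\<close>\<close>
  define l where "l x = (LEAST n. \<exists>h\<in>H. (h, x) \<in> (E\<^sup>=) ^^ n)" for x
  define U where "U = V - H"
  have l_ex: "\<exists>h\<in>H. (h, x) \<in> (E\<^sup>=) ^^ l x" if "x \<in> V" for x
    unfolding l_def
    by (rule LeastI[of "\<lambda>n. \<exists>h\<in>H. (h, x) \<in> (E\<^sup>=) ^^ n"]) (rule bspec[OF near that])
  have l_le: "l x \<le> n" if "h \<in> H" "(h, x) \<in> (E\<^sup>=) ^^ n" for h x n
    unfolding l_def using that by (blast intro: Least_le)
  have l_r: "l x \<le> r" if "x \<in> V" for x
    using bspec[OF near that] l_le by blast
  have l_H: "l x = 0" if "x \<in> H" for x
    using l_le[OF that, of x 0] by simp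
  have l_O: "l x > 0" if "x \<in> U" for x
    using l_ex[of x] that by (auto simp: U_def intro!: gr0I)
  have parent_ex: "\<exists>p. (p, x) \<in> E \<and> Suc (l p) = l x" if x: "x \<in> U" for x
  proof -
    obtain n where n: "l x = Suc n" using l_O[OF x] gr0_conv_Suc by blast
    obtain h where h: "h \<in> H" "(h, x) \<in> (E\<^sup>=) ^^ Suc n"
      using l_ex[of x] x n by (auto simp: U_def)
    then obtain p where p: "(h, p) \<in> (E\<^sup>=) ^^ n" "(p, x) \<in> E\<^sup>=" by auto
    \<comment> \<open>A pause in the last step would give a walk of length \<open>n\<close>, shorter
      than the level of \<open>x\<close>.\<close>
    have "(p, x) \<in> E"
      using p l_le[OF h(1), of x n] n by auto
    moreover from this have "p \<in> V" using E_subset by blast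
    from l_ex[OF this] obtain h' where "h' \<in> H" "(h', p) \<in> (E\<^sup>=) ^^ l p" by blast
    with \<open>(p, x) \<in> E\<close> have "l x \<le> Suc (l p)"
      by (intro l_le[of h']) auto
    with l_le[OF h(1) p(1)] n have "Suc (l p) = l x" by simp
    ultimately show ?thesis by blast
  qed
  define par where "par x = (SOME p. (p, x) \<in> E \<and> Suc (l p) = l x)" for x
  have par: "(par x, x) \<in> E" "Suc (l (par x)) = l x" if "x \<in> U" for x
    using someI_ex[OF parent_ex[OF that]] by (auto simp: par_def)
  \<comment> \<open>The ancestor on level 1: stopping one generation before \<open>H\<close> keeps
    roots in \<open>U\<close>, and the root is the only vertex of its cluster that is adjacent to
    \<open>H\<close>.\<close>
  define root where "root x = (par ^^ (l x - 1)) x" for x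
  define up where "up = {(x, y) \<in> E. x \<in> U \<and> y \<in> U \<and> root x = root y \<and> l x < l y}"
  have root: "root x \<in> U \<and> l (root x) = 1 \<and> (root x, x) \<in> (up\<^sup>=) ^^ (l x - 1)" if "x \<in> U" for x
    using that
  proof (induction "l x - 1" arbitrary: x)
    case 0
    then have "l x = 1" using l_O[of x] by simp
    with 0 show ?case by (simp add: root_def)
  next
    case (Suc n)
    have p: "(par x, x) \<in> E" "l (par x) = Suc n" "l x = Suc (Suc n)"
      using par[OF Suc.prems] Suc.hyps(2) by simp_all
    then have "par x \<in> U" using l_H E_subset by (force simp: U_def)
    moreover have "root (par x) = root x"
      by (simp add: root_def p(2,3) funpow_swap1)
    ultimately have "(par x, x) \<in> up" using p Suc.prems by (simp add: up_def)
    then show ?case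
      using Suc.hyps(1)[of "par x"] p \<open>par x \<in> U\<close> \<open>root (par x) = root x\<close> by auto
  qed
  have root_eq: "root x = x" if "l x = 1" for x
    using that by (simp add: root_def)
  have par_H: "par x \<in> H" if "x \<in> U" "l x = 1" for x
    using par[OF that(1)] that(2) l_O[of "par x"] E_subset by (force simp: U_def)
  have adj_H: "l x = 1" if "x \<in> U" "h \<in> H" "(h, x) \<in> E" for x h
    using l_le[OF that(2), of x 1] that l_O[of x] by auto

  text \<open>
    The BFS trees hanging off \<open>H\<close> form clusters, named by their roots. As the arc from a root to its
    parent is no bridge, its cluster has a second exit, to \<open>H\<close> or to another cluster. Clusters in \<open>I\<close>
    are oriented away from \<open>H\<close> and the others towards it, so the exit closes a directed walk
    from \<open>H\<close> through the root back to \<open>H\<close>.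
  \<close>
  define Q where "Q = {(v, w). v \<noteq> w \<and> (\<exists>x y. (x, y) \<in> E \<and> x \<in> U \<and> y \<in> U \<and> root x = v \<and> root y = w)}"
  have "finite U" using finite_V by (simp add: U_def)
  moreover have "sym Q" using sym_E by (fastforce simp: Q_def sym_def)
  moreover have "irrefl Q" by (auto simp: Q_def irrefl_def)
  ultimately have "\<exists>I. \<forall>(v, w)\<in>Q \<inter> U \<times> U. \<exists>u\<in>U. (v, u) \<in> Q \<and> (v \<in> I) \<noteq> (u \<in> I)"
    by (rule opposite_colouring)
  then obtain I
    where I: "\<forall>(v, w)\<in>Q \<inter> U \<times> U. \<exists>u\<in>U. (v, u) \<in> Q \<and> (v \<in> I) \<noteq> (u \<in> I)"
    by (elim exE)
  \<comment> \<open>The colour of the cluster decides. For a root in \<open>I\<close> the edge from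
    its parent leads in and its other edges to \<open>H\<close> lead out; for the other roots
    conversely. Inside a cluster arcs follow the level away from or towards the root, and between
    clusters they lead from \<open>I\<close> to its complement.\<close>
  define ori where "ori x y \<longleftrightarrow>
      x \<in> H \<and> y \<in> U \<and> (x = par y \<longleftrightarrow> y \<in> I) \<or>
      x \<in> U \<and> y \<in> H \<and> (y = par x \<longleftrightarrow> x \<notin> I) \<or>
      x \<in> U \<and> y \<in> U \<and> root x = root y \<and> (if root x \<in> I then l x < l y else l y < l x) \<or>
      x \<in> U \<and> y \<in> U \<and> root x \<noteq> root y \<and> root x \<in> I \<and> root y \<notin> I" for x y
  \<comment> \<open>Edges within \<open>H\<close> that \<open>D\<close> leaves undirected, edges
    within one level of a cluster and edges between clusters of equal colour receive no direction
    here.\<close>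
  define D1 where "D1 = D \<union> {(x, y) \<in> E. ori x y}"

  \<comment> \<open>Antisymmetry of the partial orientation\<close>
  have HO: "H \<inter> U = {}" by (auto simp: U_def)
  have not_U: "x \<notin> U" if "x \<in> H" for x
    using that HO by blast
  have ori_asym: "\<not> ori y x" if "ori x y" for x y
    using that not_U[of x] not_U[of y] unfolding ori_def
    by (cases "x \<in> H"; cases "y \<in> H"; cases "root x = root y"; cases "root x \<in> I"; simp)
  have ori_H: "\<not> ori x y" if "x \<in> H" "y \<in> H" for x y
    using not_U[OF that(1)] not_U[OF that(2)] by (simp add: ori_def)
  have D1: "D1 \<subseteq> E" "D1 \<inter> D1\<inverse> = {}"
  proof -
    show "D1 \<subseteq> E" using D(1) by (auto simp: D1_def)
    have "(y, x) \<notin> D1" if "(x, y) \<in> D1" for x y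
    proof (cases "(x, y) \<in> D")
      case True
      then have "x \<in> H" "y \<in> H" "(y, x) \<notin> D" using D by blast+
      then show ?thesis using ori_H[of y x] by (simp add: D1_def)
    next
      case False
      then have "ori x y" using that by (simp add: D1_def)
      moreover from this have "(y, x) \<notin> D" using D(1) ori_H by blast
      ultimately show ?thesis using ori_asym by (simp add: D1_def)
    qed
    then show "D1 \<inter> D1\<inverse> = {}" by auto
  qed
  have sE: "(y, x) \<in> E" if "(x, y) \<in> E" for x y
    using sym_E that by (rule symE)

  \<comment> \<open>Directed walks between a root and its cluster\<close>
  have out_walk: "(root x, x) \<in> (D1\<^sup>=) ^^ (r - 1)" if "x \<in> U" "root x \<in> I" for x
  proof -
    define w where "w = root x"
    have *: "(w, y) \<in> (D1\<^sup>=) ^^ n" if "(w, y) \<in> (up\<^sup>=) ^^ n" "root w = w" "w \<in> I" for y n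
    proof -
      \<comment> \<open>The cluster of the current vertex is carried along, as it decides the
        direction of the next arc.\<close>
      have "(w, y) \<in> (D1\<^sup>=) ^^ n \<and> root y = w"
        using that(1)
      proof (induction n arbitrary: y)
        case (Suc n)
        then obtain z where z: "(w, z) \<in> (up\<^sup>=) ^^ n" "(z, y) \<in> up\<^sup>=" by auto
        then have "(z, y) \<in> D1\<^sup>= \<and> root y = w"
          using Suc.IH[of z] that(3) by (auto simp: up_def D1_def ori_def)
        then show ?case using Suc.IH z(1) by auto
      qed (use that in simp)
      then show ?thesis by simp
    qed
    have "root w = w" using root[OF that(1)] root_eq w_def by simp
    then have "(w, x) \<in> (D1\<^sup>=) ^^ (l x - 1)"
      using * root[OF that(1)] that(2) by (simp add: w_def)
    then show ?thesis
      unfolding w_def using l_r[of x] that(1)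
      by (elim relpow_reflcl_mono) (auto simp: U_def)
  qed
  have in_walk: "(x, root x) \<in> (D1\<^sup>=) ^^ (r - 1)" if "x \<in> U" "root x \<notin> I" for x
  proof -
    define w where "w = root x"
    have *: "(y, w) \<in> (D1\<^sup>=) ^^ n" if "(w, y) \<in> (up\<^sup>=) ^^ n" "root w = w" "w \<notin> I" for y n
    proof -
      have "(y, w) \<in> (D1\<^sup>=) ^^ n \<and> root y = w"
        using that(1)
      proof (induction n arbitrary: y)
        case (Suc n)
        then obtain z where z: "(w, z) \<in> (up\<^sup>=) ^^ n" "(z, y) \<in> up\<^sup>=" by auto
        have w: "root z = w" using Suc.IH z(1) by blast
        have "(y, z) \<in> D1\<^sup>= \<and> root y = w"
        proof (cases "z = y")
          case False
          then have u: "(z, y) \<in> E" "z \<in> U" "y \<in> U" "root z = root y" "l z < l y"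
            using z(2) by (auto simp: up_def)
          then have "ori y z" using w that(3) by (simp add: ori_def)
          then show ?thesis using sE[OF u(1)] u(4) w by (simp add: D1_def)
        qed (use w in simp)
        then show ?case using Suc.IH z(1) by (meson relpow_Suc_I2)
      qed (use that in simp)
      then show ?thesis by simp
    qed
    have "root w = w" using root[OF that(1)] root_eq w_def by simp
    then have "(x, w) \<in> (D1\<^sup>=) ^^ (l x - 1)"
      using * root[OF that(1)] that(2) by (simp add: w_def)
    then show ?thesis
      unfolding w_def using l_r[of x] that(1)
      by (elim relpow_reflcl_mono) (auto simp: U_def)
  qed

  \<comment> \<open>A second exit from every cluster\<close>
  have exits: "(\<exists>y\<in>H. (v, y) \<in> E \<and> y \<noteq> par v) \<or>
      (\<exists>x y. (x, y) \<in> E \<and> x \<in> U \<and> y \<in> U \<and> root x = v \<and> root y \<noteq> v \<and>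
        (v \<in> I) \<noteq> (root y \<in> I))" if v: "v \<in> U" "l v = 1" for v
  proof -
    let ?C = "{x \<in> U. root x = v}"
    have "(v, par v) \<in> (E - {(v, par v), (par v, v)})\<^sup>*"
      using no_bridge[OF sE[OF par(1)[OF v(1)]]] .
    moreover have "v \<in> ?C" "par v \<notin> ?C"
      using v root_eq par_H[OF v] HO by auto
    ultimately obtain x y where xy: "(x, y) \<in> E - {(v, par v), (par v, v)}" "x \<in> ?C" "y \<notin> ?C"
      by (rule rtrancl_leaves_set)
    show ?thesis
    proof (cases "y \<in> H")
      case True
      \<comment> \<open>Only roots are adjacent to \<open>H\<close>, so this exit starts at
        \<open>v\<close> and differs from the deleted edge to \<open>par v\<close>.\<close>
      then have "l x = 1" using adj_H[of x y] xy sE by blast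
      then have "x = v" using root_eq xy by auto
      then show ?thesis using xy True by auto
    next
      case False
      then have y: "y \<in> U" using xy E_subset by (auto simp: U_def)
      then have "(v, root y) \<in> Q" using xy unfolding Q_def by auto
      \<comment> \<open>The cluster of \<open>y\<close> may have the colour of \<open>v\<close>; the
        colouring provides an adjacent cluster of the opposite colour.\<close>
      then obtain u where "(v, u) \<in> Q" "(v \<in> I) \<noteq> (u \<in> I)"
        using I v root[OF y] by blast
      moreover from this obtain a b
        where "(a, b) \<in> E" "a \<in> U" "b \<in> U" "root a = v" "root b = u" "v \<noteq> u"
        unfolding Q_def by blast
      ultimately show ?thesis by (intro disjI2 exI[of _ a] exI[of _ b]) simp
    qed
  qed

  \<comment> \<open>Closed walks from \<open>H\<close> through the roots\<close>
  have closed: "\<exists>h\<in>H. \<exists>h'\<in>H. \<exists>i j. i + j = 2 * r + 1 \<and> (h, v) \<in> (D1\<^sup>=) ^^ i \<and> (v, h') \<in> (D1\<^sup>=) ^^ j"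
    if v: "v \<in> U" "l v = 1" for v
  proof -
    have p: "par v \<in> H" "(par v, v) \<in> E" using par_H[OF v] par(1)[OF v(1)] by auto
    have par_arc: "(par w, w) \<in> D1" if "w \<in> U" "l w = 1" "w \<in> I" for w
      using that par_H[of w] par(1)[of w] by (auto simp: D1_def ori_def)
    have arc_par: "(w, par w) \<in> D1" if "w \<in> U" "l w = 1" "w \<notin> I" for w
      using that par_H[of w] par(1)[of w] sE by (auto simp: D1_def ori_def)
    show ?thesis
    proof (cases "v \<in> I")
      case True
      have "\<exists>h\<in>H. (v, h) \<in> (D1\<^sup>=) ^^ (2 * r)"
        using exits[OF v]
      proof
        assume "\<exists>y\<in>H. (v, y) \<in> E \<and> y \<noteq> par v"
        then obtain y where "y \<in> H" "(v, y) \<in> D1"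
          using v True by (auto simp: D1_def ori_def)
        then show ?thesis
          using relpow_reflcl_mono[of v y 1 D1 D1 "2 * r"] \<open>r > 0\<close> by auto
      next
        assume "\<exists>x y. (x, y) \<in> E \<and> x \<in> U \<and> y \<in> U \<and> root x = v \<and> root y \<noteq> v \<and>
          (v \<in> I) \<noteq> (root y \<in> I)"
        then obtain x y where xy: "(x, y) \<in> E" "x \<in> U" "y \<in> U" "root x = v" "root y \<noteq> v"
          "root y \<notin> I" using True by blast
        have "(x, y) \<in> D1" using xy True by (auto simp: D1_def ori_def)
        then have 1: "(x, y) \<in> (D1\<^sup>=) ^^ 1" by simp
        have 2: "(v, x) \<in> (D1\<^sup>=) ^^ (r - 1)" using out_walk[OF xy(2)] xy(4) True by simp
        have 3: "(y, root y) \<in> (D1\<^sup>=) ^^ (r - 1)" using in_walk[OF xy(3) xy(6)] .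
        have 4: "(root y, par (root y)) \<in> (D1\<^sup>=) ^^ 1"
          using arc_par root[OF xy(3)] xy(6) by simp
        \<comment> \<open>From \<open>v\<close> to \<open>x\<close>, across to \<open>y\<close>, on
          to \<open>root y\<close> and into \<open>H\<close>: each summand pairs a walk inside a
          cluster with a single arc.\<close>
        have "((r - 1) + 1) + ((r - 1) + 1) = 2 * r" using \<open>r > 0\<close> by simp
        then have "(v, par (root y)) \<in> (D1\<^sup>=) ^^ (2 * r)"
          using relpow_trans[OF relpow_trans[OF 2 1] relpow_trans[OF 3 4]] by (simp only:)
        moreover have "par (root y) \<in> H" using par_H root[OF xy(3)] by blast
        ultimately show ?thesis by (rule bexI)
      qed
      then obtain h where "h \<in> H" "(v, h) \<in> (D1\<^sup>=) ^^ (2 * r)" by (elim bexE)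
      moreover have "(par v, v) \<in> (D1\<^sup>=) ^^ 1" using par_arc v True by simp
      ultimately show ?thesis
        using p(1) by (intro bexI[of _ "par v"] bexI[of _ h] exI[of _ 1] exI[of _ "2 * r"]) simp_all
    next
      case False
      have "\<exists>h\<in>H. (h, v) \<in> (D1\<^sup>=) ^^ (2 * r)"
        using exits[OF v]
      proof
        assume "\<exists>y\<in>H. (v, y) \<in> E \<and> y \<noteq> par v"
        then obtain y where "y \<in> H" "(y, v) \<in> D1"
          using v False sE by (auto simp: D1_def ori_def)
        then show ?thesis
          using relpow_reflcl_mono[of y v 1 D1 D1 "2 * r"] \<open>r > 0\<close> by auto
      next
        assume "\<exists>x y. (x, y) \<in> E \<and> x \<in> U \<and> y \<in> U \<and> root x = v \<and> root y \<noteq> v \<and>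
          (v \<in> I) \<noteq> (root y \<in> I)"
        then obtain x y where xy: "(x, y) \<in> E" "x \<in> U" "y \<in> U" "root x = v" "root y \<noteq> v"
          "root y \<in> I" using False by blast
        \<comment> \<open>Mirror image of the other colour: the walk enters at
          \<open>root y\<close>, crosses from \<open>y\<close> to \<open>x\<close> and runs towards
          the root \<open>v\<close>.\<close>
        have "(y, x) \<in> D1" using xy False sE by (auto simp: D1_def ori_def)
        then have 1: "(y, x) \<in> (D1\<^sup>=) ^^ 1" by simp
        have 2: "(x, v) \<in> (D1\<^sup>=) ^^ (r - 1)" using in_walk[OF xy(2)] xy(4) False by simp
        have 3: "(root y, y) \<in> (D1\<^sup>=) ^^ (r - 1)" using out_walk[OF xy(3) xy(6)] .
        have 4: "(par (root y), root y) \<in> (D1\<^sup>=) ^^ 1"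
          using par_arc root[OF xy(3)] xy(6) by simp
        have "(1 + (r - 1)) + (1 + (r - 1)) = 2 * r" using \<open>r > 0\<close> by simp
        then have "(par (root y), v) \<in> (D1\<^sup>=) ^^ (2 * r)"
          using relpow_trans[OF relpow_trans[OF 4 3] relpow_trans[OF 1 2]] by (simp only:)
        moreover have "par (root y) \<in> H" using par_H root[OF xy(3)] by blast
        ultimately show ?thesis by (rule bexI)
      qed
      then obtain h where "h \<in> H" "(h, v) \<in> (D1\<^sup>=) ^^ (2 * r)" by (elim bexE)
      moreover have "(v, par v) \<in> (D1\<^sup>=) ^^ 1" using arc_par v False by simp
      ultimately show ?thesis
        using p(1) by (intro bexI[of _ "par v"] bexI[of _ h] exI[of _ "2 * r"] exI[of _ 1]) simp_all
    qed
  qed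

  text \<open>
    Collecting closed walks, rather than vertices close to \<open>H\<close> in both directions, ensures that the
    walks stay within \<open>H'\<close>.
  \<close>
  define H' where "H' = {x. \<exists>h\<in>H. \<exists>h'\<in>H. \<exists>i j. i + j = 2 * r + 1 \<and>
    (h, x) \<in> (D1\<^sup>=) ^^ i \<and> (x, h') \<in> (D1\<^sup>=) ^^ j}"
  define D' where "D' = D1 \<inter> H' \<times> H'"

  \<comment> \<open>Walks inside the enlarged set\<close>
  have H'I: "x \<in> H'"
    if "h \<in> H" "h' \<in> H" "(h, x) \<in> (D1\<^sup>=) ^^ i" "(x, h') \<in> (D1\<^sup>=) ^^ j" "i + j = 2 * r + 1" for h h' x i j
    unfolding H'_def using that by blast
  have H_H': "H \<subseteq> H'"
  proof
    fix h assume h: "h \<in> H"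
    show "h \<in> H'"
    proof (rule H'I[OF h h])
      show "(h, h) \<in> (D1\<^sup>=) ^^ 0" by simp
      \<comment> \<open>A closed walk consisting of pauses only.\<close>
      show "(h, h) \<in> (D1\<^sup>=) ^^ (2 * r + 1)"
        by (rule relpow_reflcl_mono[of h h 0 D1]) simp_all
    qed simp
  qed
  \<comment> \<open>Each vertex of a closed walk lies on the same walk with the total
    \<open>2 * r + 1\<close> split at another point, so the whole walk stays in
    \<open>H'\<close>.\<close>
  have from_H: "(h, x) \<in> (D'\<^sup>=) ^^ i"
    if "h \<in> H" "h' \<in> H" "i + j = 2 * r + 1" "(h, x) \<in> (D1\<^sup>=) ^^ i" "(x, h') \<in> (D1\<^sup>=) ^^ j" for h h' x i j
    using that(3-)
  proof (induction i arbitrary: x j)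
    case (Suc i)
    then obtain z where z: "(h, z) \<in> (D1\<^sup>=) ^^ i" "(z, x) \<in> D1\<^sup>=" by auto
    have zh: "(z, h') \<in> (D1\<^sup>=) ^^ Suc j" using z(2) Suc.prems(3) by (rule relpow_Suc_I2)
    have "(h, z) \<in> (D'\<^sup>=) ^^ i" using Suc.IH[OF _ z(1) zh] Suc.prems(1) by simp
    moreover have "x \<in> H'" using H'I[OF that(1,2) Suc.prems(2,3,1)] .
    moreover have "z \<in> H'" using H'I[OF that(1,2) z(1) zh] Suc.prems(1) by simp
    ultimately show ?case using z(2) by (auto simp: D'_def)
  qed simp
  have to_H: "(x, h') \<in> (D'\<^sup>=) ^^ j"
    if "h \<in> H" "h' \<in> H" "i + j = 2 * r + 1" "(h, x) \<in> (D1\<^sup>=) ^^ i" "(x, h') \<in> (D1\<^sup>=) ^^ j" for h h' x i j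
    using that(3-)
  proof (induction j arbitrary: x i)
    case (Suc j)
    obtain z where z: "(x, z) \<in> D1\<^sup>=" "(z, h') \<in> (D1\<^sup>=) ^^ j"
      using relpow_Suc_D2[OF Suc.prems(3)] by blast
    have hz: "(h, z) \<in> (D1\<^sup>=) ^^ Suc i" using Suc.prems(2) z(1) by (rule relpow_Suc_I)
    have "(z, h') \<in> (D'\<^sup>=) ^^ j" using Suc.IH[OF _ hz z(2)] Suc.prems(1) by simp
    moreover have "x \<in> H'" using H'I[OF that(1,2) Suc.prems(2,3,1)] .
    moreover have "z \<in> H'" using H'I[OF that(1,2) hz z(2)] Suc.prems(1) by simp
    ultimately have "(x, z) \<in> D'\<^sup>=" using z(1) by (auto simp: D'_def)
    then show ?case using \<open>(z, h') \<in> (D'\<^sup>=) ^^ j\<close> by (rule relpow_Suc_I2)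
  qed simp
  have "E `` H \<subseteq> H'"
  proof
    fix x assume "x \<in> E `` H"
    then obtain h where h: "h \<in> H" "(h, x) \<in> E" by blast
    show "x \<in> H'"
    proof (cases "x \<in> H")
      case False
      then have "x \<in> U" using h E_subset by (auto simp: U_def)
      then show ?thesis using closed[OF _ adj_H[OF _ h]] by (auto simp: H'_def)
    qed (use H_H' in blast)
  qed
  moreover have "D \<subseteq> D'" using D(1) H_H' by (auto simp: D'_def D1_def)
  moreover have "D' \<subseteq> E \<inter> H' \<times> H'" "D' \<inter> D'\<inverse> = {}" using D1 by (auto simp: D'_def)
  moreover have "(\<exists>h\<in>H. (h, x) \<in> (D'\<^sup>=) ^^ (2 * r + 1)) \<and> (\<exists>h\<in>H. (x, h) \<in> (D'\<^sup>=) ^^ (2 * r + 1))"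
    if x: "x \<in> H'" for x
  proof -
    obtain h h' i j where hij: "h \<in> H" "h' \<in> H" "i + j = 2 * r + 1"
      "(h, x) \<in> (D1\<^sup>=) ^^ i" "(x, h') \<in> (D1\<^sup>=) ^^ j"
      using x unfolding H'_def by blast
    have "i \<le> 2 * r + 1" "j \<le> 2 * r + 1" using hij(3) by auto
    then show ?thesis
      using relpow_reflcl_mono[OF from_H[OF hij] subset_refl]
        relpow_reflcl_mono[OF to_H[OF hij] subset_refl] hij(1,2) by blast
  qed
  ultimately show ?thesis
    using H_H' by (intro exI[of _ H'] exI[of _ D'] conjI ballI Un_least) blast+
qed

text \<open>Rounds with radii \<open>r\<close>, \<open>r - 1\<close>, ..., 1, since absorbing the
  neighbours of \<open>H\<close> lowers the radius by one. The walk lengths add up to the sum of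
  \<open>2 * j + 1\<close> over \<open>j\<close> from 1 to \<open>r\<close>, which is
  \<open>r * (r + 2)\<close>.\<close>

lemma extend_orientation:
  assumes "D \<subseteq> E \<inter> H \<times> H" "D \<inter> D\<inverse> = {}"
    and "\<forall>x\<in>V. \<exists>h\<in>H. (h, x) \<in> (E\<^sup>=) ^^ r"
  shows "\<exists>D'. D \<subseteq> D' \<and> D' \<subseteq> E \<and> D' \<inter> D'\<inverse> = {} \<and>
    (\<forall>x\<in>V. (\<exists>h\<in>H. (h, x) \<in> (D'\<^sup>=) ^^ (r * (r + 2))) \<and> (\<exists>h\<in>H. (x, h) \<in> (D'\<^sup>=) ^^ (r * (r + 2))))"
  using assms
proof (induction r arbitrary: D H)
  case 0
  have "\<exists>h\<in>H. (h, x) \<in> (D\<^sup>=) ^^ 0 \<and> (x, h) \<in> (D\<^sup>=) ^^ 0" if "x \<in> V" for x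
    using bspec[OF "0.prems"(3) that] by simp
  then show ?case using "0.prems"(1,2) by (intro exI[of _ D]) auto
next
  case (Suc r)
  obtain H1 D1 where 1: "D \<subseteq> D1" "D1 \<subseteq> E \<inter> H1 \<times> H1" "D1 \<inter> D1\<inverse> = {}" "H \<union> E `` H \<subseteq> H1"
    and walks: "\<forall>x\<in>H1. (\<exists>h\<in>H. (h, x) \<in> (D1\<^sup>=) ^^ (2 * Suc r + 1)) \<and>
      (\<exists>h\<in>H. (x, h) \<in> (D1\<^sup>=) ^^ (2 * Suc r + 1))"
    using extend_layer[OF Suc.prems zero_less_Suc] by (elim exE conjE)
  have near: "\<forall>x\<in>V. \<exists>h\<in>H1. (h, x) \<in> (E\<^sup>=) ^^ r"
  proof
    fix x assume x: "x \<in> V"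
    obtain h where h: "h \<in> H" "(h, x) \<in> (E\<^sup>=) ^^ Suc r"
      using bspec[OF Suc.prems(3) x] by (elim bexE)
    then obtain z where "(h, z) \<in> E\<^sup>=" "(z, x) \<in> (E\<^sup>=) ^^ r" using relpow_Suc_D2 by metis
    then show "\<exists>h\<in>H1. (h, x) \<in> (E\<^sup>=) ^^ r" using h(1) 1(4) by blast
  qed
  obtain D' where D': "D1 \<subseteq> D'" "D' \<subseteq> E" "D' \<inter> D'\<inverse> = {}"
    "\<forall>x\<in>V. (\<exists>h\<in>H1. (h, x) \<in> (D'\<^sup>=) ^^ (r * (r + 2))) \<and>
      (\<exists>h\<in>H1. (x, h) \<in> (D'\<^sup>=) ^^ (r * (r + 2)))"
    using Suc.IH[OF 1(2,3) near] by (elim exE conjE)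
  have sum: "(2 * Suc r + 1) + r * (r + 2) = Suc r * (Suc r + 2)"
    "r * (r + 2) + (2 * Suc r + 1) = Suc r * (Suc r + 2)" by simp_all
  have "(\<exists>h\<in>H. (h, x) \<in> (D'\<^sup>=) ^^ (Suc r * (Suc r + 2))) \<and>
      (\<exists>h\<in>H. (x, h) \<in> (D'\<^sup>=) ^^ (Suc r * (Suc r + 2)))" if x: "x \<in> V" for x
  proof
    obtain h1 where h1: "h1 \<in> H1" "(h1, x) \<in> (D'\<^sup>=) ^^ (r * (r + 2))" using bspec[OF D'(4) x] by blast
    obtain h where h: "h \<in> H" "(h, h1) \<in> (D1\<^sup>=) ^^ (2 * Suc r + 1)" using bspec[OF walks h1(1)] by blast
    have "(h, x) \<in> (D'\<^sup>=) ^^ ((2 * Suc r + 1) + r * (r + 2))"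
      using relpow_trans[OF relpow_reflcl_mono[OF h(2) D'(1) le_refl] h1(2)] .
    then show "\<exists>h\<in>H. (h, x) \<in> (D'\<^sup>=) ^^ (Suc r * (Suc r + 2))" using h(1) sum by metis
  next
    obtain h1 where h1: "h1 \<in> H1" "(x, h1) \<in> (D'\<^sup>=) ^^ (r * (r + 2))" using bspec[OF D'(4) x] by blast
    obtain h where h: "h \<in> H" "(h1, h) \<in> (D1\<^sup>=) ^^ (2 * Suc r + 1)" using bspec[OF walks h1(1)] by blast
    have "(x, h) \<in> (D'\<^sup>=) ^^ (r * (r + 2) + (2 * Suc r + 1))"
      using relpow_trans[OF h1(2) relpow_reflcl_mono[OF h(2) D'(1) le_refl]] .
    then show "\<exists>h\<in>H. (x, h) \<in> (D'\<^sup>=) ^^ (Suc r * (Suc r + 2))" using h(1) sum by metis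
  qed
  then show ?case
    using subset_trans[OF 1(1) D'(1)] D'(2,3) by (intro exI[of _ D'] conjI ballI) simp_all
qed

section \<open>A small bridgeless subgraph close to every vertex\<close>

lemma finite_E: "finite E"
  using E_subset by (rule finite_subset) (simp add: finite_V)

text \<open>Take \<open>S\<close> of largest size with a connecting \<open>T\<close>. Were some
  vertex farther than \<open>r\<close> from \<open>S\<close>, a walk leaving the
  \<open>r\<close>-neighbourhood would reach a vertex \<open>z\<close> at distance
  \<open>r + 1\<close>; adding \<open>z\<close> costs at most \<open>r + 1\<close> edges, which are
  \<open>2 * (r + 1)\<close> arcs.\<close>

lemma separated_connected_net:
  assumes conn: "V \<times> V \<subseteq> E\<^sup>*" and "V \<noteq> {}"
  shows "\<exists>S T. S \<subseteq> V \<and> S \<noteq> {} \<and> (\<forall>s\<in>S. \<forall>t\<in>S. s \<noteq> t \<longrightarrow> (s, t) \<notin> (E\<^sup>=) ^^ r) \<and>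
    T \<subseteq> E \<and> sym T \<and> (S \<union> Field T) \<times> (S \<union> Field T) \<subseteq> T\<^sup>* \<and>
    card T \<le> 2 * (r + 1) * card S \<and> (\<forall>x\<in>V. \<exists>s\<in>S. (s, x) \<in> (E\<^sup>=) ^^ r)"
proof -
  \<comment> \<open>The connector is part of the predicate, so \<open>S\<close> is largest only
    among the separated sets that have a cheap one.\<close>
  define P where "P S T \<longleftrightarrow> S \<subseteq> V \<and> S \<noteq> {} \<and> (\<forall>s\<in>S. \<forall>t\<in>S. s \<noteq> t \<longrightarrow> (s, t) \<notin> (E\<^sup>=) ^^ r) \<and>
    T \<subseteq> E \<and> sym T \<and> (S \<union> Field T) \<times> (S \<union> Field T) \<subseteq> T\<^sup>* \<and>
    card T \<le> 2 * (r + 1) * card S" for S T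
  obtain v where "v \<in> V" using assms(2) by blast
  then have "P {v} {}" by (simp add: P_def sym_def)
  then have ex: "\<exists>T. P {v} T" ..
  have "card S < Suc (card V)" if "\<exists>T. P S T" for S
    using that finite_V by (auto simp: P_def less_Suc_eq_le intro: card_mono)
  then obtain S where S: "\<exists>T. P S T" and max: "\<And>S'. \<exists>T. P S' T \<Longrightarrow> card S' \<le> card S"
    using ex_has_greatest_nat[of "\<lambda>S. \<exists>T. P S T", OF ex, of card "Suc (card V)"] by blast
  obtain T where P: "P S T" using S ..
  note S = P[unfolded P_def]
  have finS: "finite S" using S finite_V finite_subset by blast
  have finT: "finite T" using S finite_E finite_subset by blast
  have "\<exists>s\<in>S. (s, x) \<in> (E\<^sup>=) ^^ r" if x: "x \<in> V" for x
  proof (rule ccontr)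
    assume *: "\<not> (\<exists>s\<in>S. (s, x) \<in> (E\<^sup>=) ^^ r)"
    define N where "N = {x. \<exists>s\<in>S. (s, x) \<in> (E\<^sup>=) ^^ r}"
    obtain s0 where s0: "s0 \<in> S" "s0 \<in> V" using S by blast
    have "(s0, s0) \<in> (E\<^sup>=) ^^ r" by (rule relpow_reflcl_mono[of _ _ 0 E]) simp_all
    then have "s0 \<in> N" using s0(1) unfolding N_def by blast
    moreover have "(s0, x) \<in> E\<^sup>*" using conn s0(2) x by blast
    moreover have "x \<notin> N" using * by (simp add: N_def)
    \<comment> \<open>\<open>z\<close> lies just outside the neighbourhood of \<open>S\<close>: it
      is separated from all of \<open>S\<close>, yet within \<open>r + 1\<close> of some
      \<open>s\<close>.\<close>
    ultimately obtain y z where yz: "(y, z) \<in> E" "y \<in> N" "z \<notin> N" by (metis rtrancl_leaves_set)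
    obtain s where s: "s \<in> S" "(s, y) \<in> (E\<^sup>=) ^^ r" using yz(2) unfolding N_def by blast
    have "(s, z) \<in> (E\<^sup>=) ^^ (Suc r)" using relpow_Suc_I[OF s(2), of z] yz(1) by blast
    from walk_arcs[OF this]
    obtain F where F: "F \<subseteq> E" "finite F" "card F \<le> Suc r" "(s, z) \<in> F\<^sup>*"
      "\<forall>(u, v)\<in>F. (s, u) \<in> F\<^sup>*"
      by (elim exE conjE)
    define T' where "T' = T \<union> (F \<union> F\<inverse>)"
    have symT': "sym T'" using S by (auto simp: T'_def sym_def)
    have FT': "(u, v) \<in> T'\<^sup>*" if "(u, v) \<in> F\<^sup>*" for u v
      using that rtrancl_mono[of F T'] by (auto simp: T'_def)
    have TT': "(u, v) \<in> T'\<^sup>*" if "(u, v) \<in> T\<^sup>*" for u v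
      using that rtrancl_mono[of T T'] by (auto simp: T'_def)
    have from_s: "(s, u) \<in> T'\<^sup>*" if "u \<in> insert z S \<union> Field T'" for u
    proof -
      consider "u = z" | "u \<in> S \<union> Field T" | "u \<in> Domain F" | "u \<in> Range F"
        using \<open>u \<in> insert z S \<union> Field T'\<close> by (auto simp: T'_def Field_def)
      then show ?thesis
      proof cases
        case 1
        then show ?thesis using F(4) FT' by blast
      next
        case 2
        then show ?thesis using S s(1) TT' by blast
      next
        case 3
        then show ?thesis using F(5) FT' by blast
      next
        case 4
        then obtain w where "(w, u) \<in> F" by blast
        then have "(s, w) \<in> F\<^sup>*" "(w, u) \<in> F" using F(5) by auto
        then show ?thesis using FT' by (meson rtrancl_into_rtrancl)
      qed
    qed
    have z: "z \<in> V" "z \<notin> S"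
    proof -
      show "z \<in> V" using yz(1) E_subset by blast
      have "(z, z) \<in> (E\<^sup>=) ^^ r" by (rule relpow_reflcl_mono[of _ _ 0 E]) simp_all
      then show "z \<notin> S" using yz(3) by (auto simp: N_def)
    qed
    have sep: "(t, z) \<notin> (E\<^sup>=) ^^ r" "(z, t) \<notin> (E\<^sup>=) ^^ r" if "t \<in> S" for t
      using yz(3) that relpow_sym[OF sym_reflcl[OF sym_E]] unfolding N_def by blast+
    have "card T' \<le> card T + 2 * card F"
      using card_Un_le[of T "F \<union> F\<inverse>"] card_sym_closure[OF F(2)] unfolding T'_def by linarith
    also have "\<dots> \<le> 2 * (r + 1) * card (insert z S)"
      using F(3) S finS z(2) by simp
    finally have "card T' \<le> 2 * (r + 1) * card (insert z S)" .
    moreover have "(insert z S \<union> Field T') \<times> (insert z S \<union> Field T') \<subseteq> T'\<^sup>*"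
    proof (rule subrelI)
      fix x y assume "(x, y) \<in> (insert z S \<union> Field T') \<times> (insert z S \<union> Field T')"
      then have "(x, s) \<in> T'\<^sup>*" "(s, y) \<in> T'\<^sup>*" using from_s rtrancl_sym[OF symT'] by blast+
      then show "(x, y) \<in> T'\<^sup>*" by (rule rtrancl_trans)
    qed
    moreover have "T' \<subseteq> E" using S F(1) sym_E by (auto simp: T'_def sym_def)
    moreover have "\<forall>s\<in>insert z S. \<forall>t\<in>insert z S. s \<noteq> t \<longrightarrow> (s, t) \<notin> (E\<^sup>=) ^^ r"
    proof (intro ballI impI)
      fix t u assume "t \<in> insert z S" "u \<in> insert z S" "t \<noteq> u"
      then consider "t \<in> S" "u \<in> S" "t \<noteq> u" | "t = z" "u \<in> S" | "t \<in> S" "u = z" by blast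
      then show "(t, u) \<notin> (E\<^sup>=) ^^ r"
        using S sep by cases simp_all
    qed
    ultimately have "P (insert z S) T'"
      using S z(1) symT' unfolding P_def by blast
    then have "card (insert z S) \<le> card S" by (intro max exI)
    then show False using z(2) finS by simp
  qed
  then show ?thesis using S by (intro exI[of _ S] exI[of _ T]) blast
qed

text \<open>The added walk has at most \<open>2 * r + 1\<close> edges: up to \<open>r\<close>
  starting from the piece of \<open>a\<close>, one crossing edge, and up to \<open>r\<close> ending
  in the piece of \<open>b\<close>. \<open>P\<close> holds both directions of each.\<close>

lemma arc_detour:
  assumes T: "T \<subseteq> E" "sym T" "Field T \<subseteq> W" "W \<times> W \<subseteq> T\<^sup>*"
    and near: "\<forall>x\<in>V. \<exists>w\<in>W. (w, x) \<in> (E\<^sup>=) ^^ r"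
    and ab: "(a, b) \<in> T"
  shows "\<exists>P\<subseteq>E - {(a, b), (b, a)}. sym P \<and> card P \<le> 2 * (2 * r + 1) \<and>
    (a, b) \<in> (T - {(a, b), (b, a)} \<union> P)\<^sup>*"
proof -
  define E' where "E' = E - {(a, b), (b, a)}"
  define T' where "T' = T - {(a, b), (b, a)}"
  have sym': "sym E'" "sym T'" using sym_E T(2) by (auto simp: E'_def T'_def sym_def)
  have abW: "a \<in> W" "b \<in> W" using ab T(3) by (auto simp: Field_def)
  have abV: "a \<in> V" "b \<in> V" using ab T(1) E_subset by auto
  \<comment> \<open>Deleting the edge splits the connected \<open>T\<close> into at most two pieces,
    one containing \<open>a\<close> and one containing \<open>b\<close>.\<close>
  have side: "(a, w) \<in> T'\<^sup>* \<or> (b, w) \<in> T'\<^sup>*" if "w \<in> W" for w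
  proof -
    have "(a, w) \<in> T\<^sup>*" using T(4) abW(1) that by blast
    then show ?thesis
    proof (induction rule: rtrancl_induct)
      case (step y z)
      show ?case
      proof (cases "(y, z) \<in> T'")
        case True
        then show ?thesis using step.IH by (meson rtrancl_into_rtrancl)
      next
        case False
        then have "z = a \<or> z = b" using step.hyps(2) by (auto simp: T'_def)
        then show ?thesis by blast
      qed
    qed simp
  qed
  \<comment> \<open>A walk that crosses the deleted edge is restarted at the end of its last
    crossing, which lies in \<open>W\<close>.\<close>
  have near': "\<exists>w'\<in>W. (w', x) \<in> (E'\<^sup>=) ^^ n" if "w \<in> W" "(w, x) \<in> (E\<^sup>=) ^^ n" for w x n
    using that(2)
  proof (induction n arbitrary: x)
    case 0
    then show ?case using that(1) by simp
  next
    case (Suc n)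
    obtain y where y: "(w, y) \<in> (E\<^sup>=) ^^ n" "(y, x) \<in> E\<^sup>=" using Suc.prems by (rule relpow_Suc_E)
    obtain w' where w': "w' \<in> W" "(w', y) \<in> (E'\<^sup>=) ^^ n" using Suc.IH[OF y(1)] by (elim bexE)
    show ?case
    proof (cases "(y, x) \<in> E'\<^sup>=")
      case True
      with w'(2) have "(w', x) \<in> (E'\<^sup>=) ^^ Suc n" by (rule relpow_Suc_I)
      then show ?thesis using w'(1) by (rule bexI)
    next
      case False
      then have "x = a \<or> x = b" using y(2) by (auto simp: E'_def)
      then have "x \<in> W" using abW by blast
      moreover have "(x, x) \<in> (E'\<^sup>=) ^^ Suc n"
        by (rule relpow_reflcl_mono[of _ _ 0 E']) simp_all
      ultimately show ?thesis by (rule bexI[rotated])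
    qed
  qed
  \<comment> \<open>It thus suffices to find a short walk in \<open>E'\<close> between the two
    pieces.\<close>
  have build: ?thesis if w: "(a, w) \<in> T'\<^sup>*" "(b, w') \<in> T'\<^sup>*" "(w, w') \<in> (E'\<^sup>=) ^^ (2 * r + 1)" for w w'
  proof -
    obtain F where F: "F \<subseteq> E'" "finite F" "card F \<le> 2 * r + 1" "(w, w') \<in> F\<^sup>*"
      using walk_arcs[OF w(3)] by (elim exE conjE)
    let ?P = "F \<union> F\<inverse>"
    have mono: "(x, y) \<in> (T' \<union> ?P)\<^sup>*" if "(x, y) \<in> T'\<^sup>* \<or> (x, y) \<in> F\<^sup>*" for x y
      using that rtrancl_mono[of T' "T' \<union> ?P"] rtrancl_mono[of F "T' \<union> ?P"] by auto
    have "(a, w) \<in> (T' \<union> ?P)\<^sup>*" "(w, w') \<in> (T' \<union> ?P)\<^sup>*" "(w', b) \<in> (T' \<union> ?P)\<^sup>*"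
      using mono w(1) F(4) rtrancl_sym[OF sym'(2) w(2)] by blast+
    then have "(a, b) \<in> (T' \<union> ?P)\<^sup>*" by (meson rtrancl_trans)
    moreover have "?P \<subseteq> E'" using F(1) sym'(1) by (auto simp: sym_def)
    moreover have "card ?P \<le> 2 * (2 * r + 1)" using card_sym_closure[OF F(2)] mult_le_mono2[OF F(3)] by (rule order_trans)
    moreover have "sym ?P" by (auto simp: sym_def)
    ultimately show ?thesis unfolding E'_def[symmetric] T'_def[symmetric] by blast
  qed
  text \<open>
    Removing the arc leaves every vertex close to the side of \<open>a\<close> or to the side of \<open>b\<close>, and
    some remaining arc joins the two regions.
  \<close>
  define X where "X = {x. \<exists>w\<in>W. (a, w) \<in> T'\<^sup>* \<and> (w, x) \<in> (E'\<^sup>=) ^^ r}"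
  show ?thesis
  proof (cases "b \<in> X")
    case True
    then obtain w where w: "(a, w) \<in> T'\<^sup>*" "(w, b) \<in> (E'\<^sup>=) ^^ r" unfolding X_def by blast
    have "(w, b) \<in> (E'\<^sup>=) ^^ (2 * r + 1)" using w(2) by (rule relpow_reflcl_mono) simp_all
    with w(1) show ?thesis by (intro build) simp_all
  next
    case False
    have "(a, a) \<in> (E'\<^sup>=) ^^ r" by (rule relpow_reflcl_mono[of _ _ 0 E']) simp_all
    then have "a \<in> X" using abW(1) unfolding X_def by blast
    moreover have "(a, b) \<in> E'\<^sup>*" using no_bridge ab T(1) by (auto simp: E'_def)
    ultimately obtain u v where uv: "(u, v) \<in> E'" "u \<in> X" "v \<notin> X"
      using False by (metis rtrancl_leaves_set)
    obtain w where w: "(a, w) \<in> T'\<^sup>*" "(w, u) \<in> (E'\<^sup>=) ^^ r" using uv(2) unfolding X_def by blast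
    have "v \<in> V" using uv(1) E_subset by (auto simp: E'_def)
    then obtain w' where w': "w' \<in> W" "(w', v) \<in> (E'\<^sup>=) ^^ r"
      using bspec[OF near] near' by blast
    have "(b, w') \<in> T'\<^sup>*" using side[OF w'(1)] uv(3) w' unfolding X_def by blast
    moreover have "(w, w') \<in> (E'\<^sup>=) ^^ (2 * r + 1)"
    proof -
      have "(v, w') \<in> (E'\<^sup>=) ^^ r" using w'(2) by (rule relpow_sym[OF sym_reflcl[OF sym'(1)]])
      moreover have "(u, v) \<in> E'\<^sup>=" using uv(1) by simp
      ultimately have "(w, w') \<in> (E'\<^sup>=) ^^ (Suc r + r)"
        using w(2) by (blast intro: relpow_trans relpow_Suc_I)
      then show ?thesis by (simp add: mult_2)
    qed
    ultimately show ?thesis using w(1) by (intro build)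
  qed
qed

text \<open>Detours added for the arcs of \<open>T\<close> may contain new bridges. A smallest
  subgraph that still gives every arc of \<open>T\<close> a detour has none, and no stray components
  either. The count is \<open>card T\<close> plus at most \<open>4 * r + 2\<close> for each arc of
  \<open>T\<close>.\<close>

lemma bridgeless_extension:
  assumes T: "T \<subseteq> E" "sym T" "Field T \<subseteq> W" "W \<times> W \<subseteq> T\<^sup>*"
    and near: "\<forall>x\<in>V. \<exists>w\<in>W. (w, x) \<in> (E\<^sup>=) ^^ r"
  shows "\<exists>H. T \<subseteq> H \<and> H \<subseteq> E \<and> sym H \<and> card H \<le> (4 * r + 3) * card T \<and>
    (\<forall>(x, y)\<in>H. (x, y) \<in> (H - {(x, y), (y, x)})\<^sup>* \<and> (\<exists>a\<in>Field T. (a, x) \<in> H\<^sup>*))"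
proof -
  define C where "C H \<longleftrightarrow> T \<subseteq> H \<and> H \<subseteq> E \<and> sym H \<and> (\<forall>(a, b)\<in>T. (a, b) \<in> (H - {(a, b), (b, a)})\<^sup>*)" for H
  have finT: "finite T" using T(1) finite_E by (rule finite_subset)
  have "\<forall>e\<in>T. \<exists>P. P \<subseteq> E - {e, prod.swap e} \<and> sym P \<and> card P \<le> 2 * (2 * r + 1) \<and>
      e \<in> (T - {e, prod.swap e} \<union> P)\<^sup>*"
  proof
    fix e assume "e \<in> T"
    then show "\<exists>P. P \<subseteq> E - {e, prod.swap e} \<and> sym P \<and> card P \<le> 2 * (2 * r + 1) \<and>
      e \<in> (T - {e, prod.swap e} \<union> P)\<^sup>*"
      using arc_detour[OF T near, of "fst e" "snd e"] by (cases e) simp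
  qed
  then obtain P where P: "\<forall>e\<in>T. P e \<subseteq> E - {e, prod.swap e} \<and> sym (P e) \<and>
      card (P e) \<le> 2 * (2 * r + 1) \<and> e \<in> (T - {e, prod.swap e} \<union> P e)\<^sup>*"
    by (auto dest!: bchoice)
  define H0 where "H0 = T \<union> (\<Union>e\<in>T. P e)"
  have "C H0"
    unfolding C_def
  proof (intro conjI)
    show "T \<subseteq> H0" by (simp add: H0_def)
    show "H0 \<subseteq> E" using P T(1) by (auto simp: H0_def)
    show "sym H0" using P T(2) unfolding H0_def by (intro sym_Un sym_UNION) auto
    show "\<forall>(a, b)\<in>T. (a, b) \<in> (H0 - {(a, b), (b, a)})\<^sup>*"
    proof safe
      fix a b assume ab: "(a, b) \<in> T"
      with P have *: "P (a, b) \<subseteq> E - {(a, b), (b, a)}" "(a, b) \<in> (T - {(a, b), (b, a)} \<union> P (a, b))\<^sup>*"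
        by (metis swap_simp)+
      have "T - {(a, b), (b, a)} \<union> P (a, b) \<subseteq> H0 - {(a, b), (b, a)}"
        using *(1) ab by (auto simp: H0_def)
      then show "(a, b) \<in> (H0 - {(a, b), (b, a)})\<^sup>*"
        using *(2) rtrancl_mono by blast
    qed
  qed
  have "card H0 \<le> card T + card (\<Union>e\<in>T. P e)" unfolding H0_def by (rule card_Un_le)
  also have "card (\<Union>e\<in>T. P e) \<le> (\<Sum>e\<in>T. card (P e))" by (rule card_UN_le[OF finT])
  also have "\<dots> \<le> (\<Sum>e\<in>T. 2 * (2 * r + 1))" using P by (intro sum_mono) blast
  also have "card T + \<dots> = (4 * r + 3) * card T" by (simp add: algebra_simps)
  finally have card_H0: "card H0 \<le> (4 * r + 3) * card T" by simp
  obtain H where CH: "C H" and min: "\<And>H'. C H' \<Longrightarrow> card H \<le> card H'"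
    using ex_has_least_nat[of C H0 card] \<open>C H0\<close> by blast
  have finH: "finite H" using CH finite_E by (auto simp: C_def intro: finite_subset)
  have "(x, y) \<in> (H - {(x, y), (y, x)})\<^sup>* \<and> (\<exists>a\<in>Field T. (a, x) \<in> H\<^sup>*)" if xy: "(x, y) \<in> H" for x y
  proof (cases "(x, y) \<in> T")
    case True
    then show ?thesis using CH by (auto simp: C_def Field_def intro!: bexI[of _ x])
  next
    case False
    define H1 where "H1 = H - {(x, y), (y, x)}"
    text \<open>
      By minimality the removal of the arc disconnects some arc of \<open>T\<close>, so the arc joins the two sides
      of that arc, and these are connected through \<open>T\<close>.
    \<close>
    have T_H1: "T \<subseteq> H1" using False T(2) CH by (auto simp: C_def H1_def sym_def)
    have sym_H1: "sym H1" using CH by (auto simp: C_def H1_def sym_def)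
    have "card H1 < card H" unfolding H1_def using finH xy by (intro psubset_card_mono) auto
    then have "\<not> C H1" using min[of H1] by linarith
    moreover have "H1 \<subseteq> E" using CH by (auto simp: C_def H1_def)
    ultimately obtain a b where ab: "(a, b) \<in> T" "(a, b) \<notin> (H1 - {(a, b), (b, a)})\<^sup>*"
      using T_H1 sym_H1 unfolding C_def by blast
    define R where "R = H - {(a, b), (b, a)}"
    have R': "R - {(x, y), (y, x)} = H1 - {(a, b), (b, a)}" by (auto simp: R_def H1_def)
    have "(a, b) \<in> R\<^sup>*" using CH ab(1) by (auto simp: C_def R_def)
    from rtrancl_split_arc[OF this, of x y] ab(2)
    have "(a, x) \<in> (H1 - {(a, b), (b, a)})\<^sup>* \<and> (y, b) \<in> (H1 - {(a, b), (b, a)})\<^sup>* \<or>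
        (a, y) \<in> (H1 - {(a, b), (b, a)})\<^sup>* \<and> (x, b) \<in> (H1 - {(a, b), (b, a)})\<^sup>*"
      unfolding R' Let_def by blast
    then have split: "(a, x) \<in> H1\<^sup>* \<and> (y, b) \<in> H1\<^sup>* \<or> (a, y) \<in> H1\<^sup>* \<and> (x, b) \<in> H1\<^sup>*"
      using rtrancl_mono[of "H1 - {(a, b), (b, a)}" H1] by blast
    have "(a, b) \<in> H1" using ab(1) T_H1 by blast
    then have ab': "(a, b) \<in> H1\<^sup>*" by blast
    have rs: "(v, u) \<in> H1\<^sup>*" if "(u, v) \<in> H1\<^sup>*" for u v using rtrancl_sym[OF sym_H1 that] .
    have ax: "(a, x) \<in> H1\<^sup>*" using split ab' rs by (meson rtrancl_trans)
    have ay: "(a, y) \<in> H1\<^sup>*" using split ab' rs by (meson rtrancl_trans)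
    have "(x, y) \<in> H1\<^sup>*" using rs[OF ax] ay by (rule rtrancl_trans)
    moreover have "(a, x) \<in> H\<^sup>*" using ax rtrancl_mono[of H1 H] by (auto simp: H1_def)
    moreover have "a \<in> Field T" using ab(1) by (auto simp: Field_def)
    ultimately show ?thesis unfolding H1_def by blast
  qed
  moreover have "card H \<le> (4 * r + 3) * card T" using min[OF \<open>C H0\<close>] card_H0 by linarith
  ultimately show ?thesis using CH unfolding C_def by (intro exI[of _ H]) blast
qed

text \<open>Net, bridgeless extension and layer extension combined: a vertex reaches the small
  subgraph in \<open>r * (r + 2)\<close> steps, crosses it in at most \<open>card H\<close> steps,
  and leaves it in another \<open>r * (r + 2)\<close>.\<close>

lemma short_orientation:
  assumes conn: "V \<times> V \<subseteq> E\<^sup>*" and "V \<noteq> {}"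
  shows "\<exists>S D. S \<subseteq> V \<and> (\<forall>s\<in>S. \<forall>t\<in>S. s \<noteq> t \<longrightarrow> (s, t) \<notin> (E\<^sup>=) ^^ r) \<and>
    D \<subseteq> E \<and> D \<inter> D\<inverse> = {} \<and>
    (\<forall>x\<in>V. \<forall>y\<in>V. (x, y) \<in> (D\<^sup>=) ^^ (2 * (r + 1) * (4 * r + 3) * card S + 2 * (r * (r + 2))))"
proof -
  obtain S T where S: "S \<subseteq> V" "S \<noteq> {}" "\<forall>s\<in>S. \<forall>t\<in>S. s \<noteq> t \<longrightarrow> (s, t) \<notin> (E\<^sup>=) ^^ r"
    and T: "T \<subseteq> E" "sym T" "(S \<union> Field T) \<times> (S \<union> Field T) \<subseteq> T\<^sup>*"
      "card T \<le> 2 * (r + 1) * card S"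
    and near: "\<forall>x\<in>V. \<exists>s\<in>S. (s, x) \<in> (E\<^sup>=) ^^ r"
    using separated_connected_net[OF assms, of r] by (elim exE conjE)
  have near_T: "\<forall>x\<in>V. \<exists>w\<in>S \<union> Field T. (w, x) \<in> (E\<^sup>=) ^^ r"
    using near by blast
  obtain H where H: "T \<subseteq> H" "H \<subseteq> E" "sym H" "card H \<le> (4 * r + 3) * card T"
    and bl: "\<forall>(x, y)\<in>H. (x, y) \<in> (H - {(x, y), (y, x)})\<^sup>* \<and> (\<exists>a\<in>Field T. (a, x) \<in> H\<^sup>*)"
    using bridgeless_extension[OF T(1,2) Un_upper2 T(3) near_T] by (elim exE conjE)
  \<comment> \<open>\<open>S\<close> is included because \<open>T\<close> and \<open>H\<close> may
    be empty when \<open>S\<close> is a single vertex.\<close>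
  define U where "U = S \<union> Field H"
  have finH: "finite H" using H(2) finite_E by (rule finite_subset)
  obtain s where s: "s \<in> S" using S(2) by blast
  have conn_H: "(s, x) \<in> H\<^sup>*" if "x \<in> U" for x
  proof (cases "x \<in> S")
    case True
    then have "(s, x) \<in> T\<^sup>*" using T(3) s by blast
    then show ?thesis using rtrancl_mono[OF H(1)] by blast
  next
    case False
    then have "x \<in> Field H" using \<open>x \<in> U\<close> by (simp add: U_def)
    then obtain y where "(x, y) \<in> H" using H(3) unfolding Field_def sym_def by blast
    then obtain a where a: "a \<in> Field T" "(a, x) \<in> H\<^sup>*" using bl by blast
    have "(s, a) \<in> T\<^sup>*" using T(3) s a(1) by blast
    then have "(s, a) \<in> H\<^sup>*" using rtrancl_mono[OF H(1)] by blast
    then show ?thesis using a(2) by (rule rtrancl_trans)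
  qed
  have U_V: "U \<subseteq> V" using S(1) H(2) E_subset by (auto simp: U_def Field_def)
  interpret H: bridgeless_graph U H
  proof
    show "finite U" using U_V finite_V by (rule finite_subset)
    show "H \<subseteq> U \<times> U" by (auto simp: U_def Field_def)
    show "sym H" by fact
    show "irrefl H" using irrefl_E H(2) by (auto simp: irrefl_def)
    show "(x, y) \<in> (H - {(x, y), (y, x)})\<^sup>*" if "(x, y) \<in> H" for x y using bl that by blast
  qed
  \<comment> \<open>Growing from a single vertex with the crude radius \<open>card H\<close> makes
    the subgraph strongly connected; the quadratic distance bound obtained on the way is then
    replaced by the number of arcs.\<close>
  have "\<forall>x\<in>U. \<exists>h\<in>{s}. (h, x) \<in> (H\<^sup>=) ^^ card H"
    using finite_rtrancl_relpow_reflcl[OF finH conn_H le_refl] by blast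
  then obtain D where D: "D \<subseteq> H" "D \<inter> D\<inverse> = {}"
    "\<forall>x\<in>U. (\<exists>h\<in>{s}. (h, x) \<in> (D\<^sup>=) ^^ (card H * (card H + 2))) \<and>
      (\<exists>h\<in>{s}. (x, h) \<in> (D\<^sup>=) ^^ (card H * (card H + 2)))"
    using H.extend_orientation[of "{}" "{s}" "card H"] by auto
  have strong_D: "(x, y) \<in> (D\<^sup>=) ^^ card H" if "x \<in> U" "y \<in> U" for x y
  proof (rule finite_rtrancl_relpow_reflcl)
    show "finite D" using D(1) finH by (rule finite_subset)
    show "card D \<le> card H" using finH D(1) by (rule card_mono)
    have "(x, s) \<in> D\<^sup>*" "(s, y) \<in> D\<^sup>*"
      using D(3) that by (auto dest!: relpow_reflcl_rtrancl)
    then show "(x, y) \<in> D\<^sup>*" by (rule rtrancl_trans)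
  qed
  have D_U: "D \<subseteq> E \<inter> U \<times> U" using D(1) H(2) by (auto simp: U_def Field_def)
  have near_U: "\<forall>x\<in>V. \<exists>h\<in>U. (h, x) \<in> (E\<^sup>=) ^^ r" using near unfolding U_def by blast
  obtain D' where D': "D \<subseteq> D'" "D' \<subseteq> E" "D' \<inter> D'\<inverse> = {}"
    "\<forall>x\<in>V. (\<exists>h\<in>U. (h, x) \<in> (D'\<^sup>=) ^^ (r * (r + 2))) \<and> (\<exists>h\<in>U. (x, h) \<in> (D'\<^sup>=) ^^ (r * (r + 2)))"
    using extend_orientation[OF D_U D(2) near_U] by (elim exE conjE)
  have cardH: "card H \<le> 2 * (r + 1) * (4 * r + 3) * card S"
  proof -
    have "card H \<le> (4 * r + 3) * (2 * (r + 1) * card S)"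
      using H(4) mult_le_mono2[OF T(4)] by (rule order_trans)
    then show ?thesis by (simp only: mult_ac)
  qed
  have "(x, y) \<in> (D'\<^sup>=) ^^ (2 * (r + 1) * (4 * r + 3) * card S + 2 * (r * (r + 2)))"
    if xy: "x \<in> V" "y \<in> V" for x y
  proof -
    obtain h where h: "h \<in> U" "(x, h) \<in> (D'\<^sup>=) ^^ (r * (r + 2))"
      using bspec[OF D'(4) xy(1)] by (elim conjE bexE)
    obtain h' where h': "h' \<in> U" "(h', y) \<in> (D'\<^sup>=) ^^ (r * (r + 2))"
      using bspec[OF D'(4) xy(2)] by (elim conjE bexE)
    have "(h, h') \<in> (D'\<^sup>=) ^^ card H"
      using strong_D[OF h(1) h'(1)] by (rule relpow_reflcl_mono) (use D'(1) in simp_all)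
    then have "(x, y) \<in> (D'\<^sup>=) ^^ (r * (r + 2) + (card H + r * (r + 2)))"
      by (intro relpow_trans[OF h(2)] relpow_trans[OF _ h'(2)])
    then show ?thesis
      by (rule relpow_reflcl_mono) (use cardH in simp_all)
  qed
  then show ?thesis using S(1,3) D'(2,3) by (intro exI[of _ S] exI[of _ D']) blast
qed

end

section \<open>Balls in graphs of large girth\<close>

text \<open>Up to depth \<open>k\<close> the breadth-first search from \<open>v\<close> sees a tree:
  an edge inside a level or a second parent would close a cycle of length at most
  \<open>2 * k\<close>. So a vertex on a level less than \<open>k\<close> has at least
  \<open>d - 1\<close> children, and distinct vertices of one level share none.\<close>

lemma ball_size:
  fixes k d :: nat
  assumes "finite V" "E \<subseteq> V \<times> V" "sym E"
    and degree: "\<And>x. x \<in> V \<Longrightarrow> d \<le> card (E `` {x})"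
    and cycles: "\<And>x y m. \<lbrakk>(y, x) \<in> E; (x, y) \<in> (E - {(x, y), (y, x)}) ^^ m\<rbrakk> \<Longrightarrow> 2 * k \<le> m"
    and "v \<in> V"
  shows "(d - 1) ^ k \<le> card {x. (v, x) \<in> (E\<^sup>=) ^^ k}"
proof -
  define l where "l x = (LEAST n. (v, x) \<in> (E\<^sup>=) ^^ n)" for x
  define L where "L i = {x. (v, x) \<in> E\<^sup>* \<and> l x = i}" for i
  have l_le: "l x \<le> n" if "(v, x) \<in> (E\<^sup>=) ^^ n" for x n
    unfolding l_def using that by (rule Least_le)
  have l_walk: "(v, x) \<in> (E\<^sup>=) ^^ l x" if "(v, x) \<in> E\<^sup>*" for x
  proof -
    have "(v, x) \<in> (E\<^sup>=)\<^sup>*" using that by simp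
    then obtain n where "(v, x) \<in> (E\<^sup>=) ^^ n" unfolding rtrancl_power ..
    then show ?thesis unfolding l_def by (rule LeastI)
  qed
  have sE: "(y, x) \<in> E" if "(x, y) \<in> E" for x y
    using \<open>sym E\<close> that by (rule symE)
  have finE: "finite E" using assms(2) by (rule finite_subset) (simp add: assms(1))
  have L_V: "L i \<subseteq> V" for i
  proof
    fix x assume "x \<in> L i"
    then have "(v, x) \<in> E\<^sup>*" by (simp add: L_def)
    then show "x \<in> V" using assms(2) \<open>v \<in> V\<close> by (cases rule: rtranclE) auto
  qed
  have finL: "finite (L i)" for i using L_V assms(1) by (rule finite_subset)
  have step: "(v, y) \<in> E\<^sup>* \<and> l y \<le> Suc (l x)" if "(v, x) \<in> E\<^sup>*" "(x, y) \<in> E" for x y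
  proof
    show "(v, y) \<in> E\<^sup>*" using that by (rule rtrancl_into_rtrancl)
    have "(v, y) \<in> (E\<^sup>=) ^^ Suc (l x)" using relpow_Suc_I[OF l_walk[OF that(1)], of y] that(2) by blast
    then show "l y \<le> Suc (l x)" by (rule l_le)
  qed
  \<comment> \<open>Arcs of geodesics from \<open>v\<close>, cut off at level \<open>i\<close>.
    Walks along them in either direction avoid edges inside a level and edges that reach level
    \<open>i + 1\<close>.\<close>
  define R where "R i = {(p, q) \<in> E. l q = Suc (l p) \<and> l q \<le> i}" for i
  have geodesic: "(v, x) \<in> R i ^^ i" if "x \<in> L i" for x i
    using that
  proof (induction i arbitrary: x)
    case 0
    then have "(v, x) \<in> (E\<^sup>=) ^^ 0" using l_walk[of x] by (simp add: L_def)
    then show ?case by simp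
  next
    case (Suc i)
    then have x: "(v, x) \<in> (E\<^sup>=) ^^ Suc i" "l x = Suc i" using l_walk[of x] by (simp_all add: L_def)
    obtain p where p: "(v, p) \<in> (E\<^sup>=) ^^ i" "(p, x) \<in> E\<^sup>=" using x(1) by (rule relpow_Suc_E)
    have lp: "l p \<le> i" using p(1) by (rule l_le)
    then have px: "(p, x) \<in> E" using p(2) x(2) by auto
    have vp: "(v, p) \<in> E\<^sup>*" using p(1) by (rule relpow_reflcl_rtrancl)
    have "l p = i" using step[OF vp px] lp x(2) by simp
    then have "(v, p) \<in> R i ^^ i" using vp by (intro Suc.IH) (simp add: L_def)
    moreover have "R i \<subseteq> R (Suc i)" by (auto simp: R_def)
    ultimately have "(v, p) \<in> R (Suc i) ^^ i" unfolding relpow_fun_conv by blast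
    moreover have "(p, x) \<in> R (Suc i)" using px x(2) \<open>l p = i\<close> by (simp add: R_def)
    ultimately show ?case by (rule relpow_Suc_I)
  qed
  have R_level: "R i \<union> (R i)\<inverse> \<subseteq> {(p, q) \<in> E. l p \<noteq> l q \<and> l p \<le> i \<and> l q \<le> i}" for i
    using \<open>sym E\<close> by (auto simp: R_def sym_def)
  have via_v: "(x, y) \<in> (R i \<union> (R i)\<inverse>) ^^ (i + i)" if "x \<in> L i" "y \<in> L i" for x y i
  proof -
    have *: "(v, z) \<in> (R i \<union> (R i)\<inverse>) ^^ i" if "z \<in> L i" for z
      using geodesic[OF that] unfolding relpow_fun_conv by blast
    have "sym (R i \<union> (R i)\<inverse>)" by (auto simp: sym_def)
    then have "(x, v) \<in> (R i \<union> (R i)\<inverse>) ^^ i" using *[OF that(1)] by (rule relpow_sym)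
    then show ?thesis using *[OF that(2)] by (rule relpow_trans)
  qed
  have no_level_edge: "(x, y) \<notin> E" if "x \<in> L i" "y \<in> L i" "i < k" for x y i
  proof
    assume xy: "(x, y) \<in> E"
    have "R i \<union> (R i)\<inverse> \<subseteq> E - {(x, y), (y, x)}"
      by (rule order_trans[OF R_level]) (use that(1,2) in \<open>auto simp: L_def\<close>)
    then have "(x, y) \<in> (E - {(x, y), (y, x)}) ^^ (i + i)"
      using via_v[OF that(1,2)] unfolding relpow_fun_conv by blast
    \<comment> \<open>The walk from \<open>x\<close> through \<open>v\<close> to \<open>y\<close>
      avoids the edge \<open>xy\<close> and has only \<open>2 * i\<close> arcs.\<close>
    then have "2 * k \<le> i + i" by (rule cycles[OF sE[OF xy]])
    then show False using \<open>i < k\<close> by simp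
  qed
  have parent_unique: "x = x'"
    if "x \<in> L i" "x' \<in> L i" "y \<in> L (Suc i)" "(x, y) \<in> E" "(x', y) \<in> E" "i < k" for x x' y i
  proof (rule ccontr)
    assume "x \<noteq> x'"
    have "R i \<union> (R i)\<inverse> \<subseteq> E - {(x, y), (y, x)}"
      by (rule order_trans[OF R_level]) (use that(3) in \<open>auto simp: L_def\<close>)
    then have "(x, x') \<in> (E - {(x, y), (y, x)}) ^^ (i + i)"
      using via_v[OF that(1,2)] unfolding relpow_fun_conv by blast
    moreover have "(x', y) \<in> E - {(x, y), (y, x)}"
      using that \<open>x \<noteq> x'\<close> by (auto simp: L_def)
    \<comment> \<open>The detour through \<open>v\<close> and the second parent \<open>x'\<close>
      has \<open>2 * i + 1\<close> arcs, which is still less than \<open>2 * k\<close> for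
      \<open>i < k\<close>.\<close>
    ultimately have "(x, y) \<in> (E - {(x, y), (y, x)}) ^^ Suc (i + i)" by (rule relpow_Suc_I)
    then have "2 * k \<le> Suc (i + i)" by (rule cycles[OF sE[OF that(4)]])
    then show False using \<open>i < k\<close> by simp
  qed
  have children: "d - 1 \<le> card (L (Suc i) \<inter> E `` {x})" if x: "x \<in> L i" "i < k" for x i
  proof -
    \<comment> \<open>The neighbours of \<open>x\<close> on the previous level: at most one, and
      none for \<open>v\<close> itself on level 0.\<close>
    define P where "P = {p. (x, p) \<in> E \<and> l p < i}"
    have "P = {} \<or> (\<exists>p. P \<subseteq> {p})"
    proof (cases i)
      case (Suc j)
      have P: "p \<in> L j" "(p, x) \<in> E" if "p \<in> P" for p
      proof -
        have p: "(x, p) \<in> E" "l p < i" using that by (simp_all add: P_def)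
        show "(p, x) \<in> E" using p(1) by (rule sE)
        have "(v, p) \<in> E\<^sup>*" using step[OF _ p(1)] x(1) by (simp add: L_def)
        then show "p \<in> L j"
          using step[OF _ \<open>(p, x) \<in> E\<close>] p(2) x(1) Suc by (simp add: L_def)
      qed
      have "p = q" if "p \<in> P" "q \<in> P" for p q
        using parent_unique[OF P(1)[OF that(1)] P(1)[OF that(2)] _ P(2)[OF that(1)] P(2)[OF that(2)]]
          x Suc by simp
      then show ?thesis by blast
    qed (simp add: P_def)
    then have "card P \<le> 1" by (auto intro: order_trans[OF card_mono])
    have "E `` {x} \<subseteq> P \<union> (L (Suc i) \<inter> E `` {x})"
    proof
      fix y assume "y \<in> E `` {x}"
      then have y: "(x, y) \<in> E" by simp
      have "y \<notin> L i" using no_level_edge[OF x(1) _ x(2)] y by blast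
      then show "y \<in> P \<union> (L (Suc i) \<inter> E `` {x})"
        using step[OF _ y] x(1) y by (auto simp: P_def L_def)
    qed
    moreover have "finite P" using finE by (rule finite_subset[rotated, OF finite_Range]) (auto simp: P_def)
    ultimately have "card (E `` {x}) \<le> card P + card (L (Suc i) \<inter> E `` {x})"
      using finL by (intro order_trans[OF card_mono card_Un_le]) auto
    moreover have "d \<le> card (E `` {x})" using degree x(1) L_V by blast
    ultimately show ?thesis using \<open>card P \<le> 1\<close> by linarith
  qed
  have "(d - 1) ^ i \<le> card (L i)" if "i \<le> k" for i
    using that
  proof (induction i)
    case 0
    have "(v, v) \<in> (E\<^sup>=) ^^ 0" by simp
    then have "l v = 0" using l_le by blast
    then have "v \<in> L 0" by (simp add: L_def)
    then have "card {v} \<le> card (L 0)" using finL by (intro card_mono) auto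
    then show ?case by simp
  next
    case (Suc i)
    have "(d - 1) ^ Suc i \<le> (\<Sum>x\<in>L i. d - 1)" using Suc by simp
    also have "\<dots> \<le> (\<Sum>x\<in>L i. card (L (Suc i) \<inter> E `` {x}))"
      using children Suc.prems by (intro sum_mono) simp
    also have "\<dots> = card (\<Union>x\<in>L i. L (Suc i) \<inter> E `` {x})"
      using finL Suc.prems parent_unique by (intro card_UN_disjoint[symmetric]) fastforce+
    also have "\<dots> \<le> card (L (Suc i))" using finL by (intro card_mono) auto
    finally show ?case .
  qed
  from this[of k] have "(d - 1) ^ k \<le> card (L k)" by simp
  also have "\<dots> \<le> card {x. (v, x) \<in> (E\<^sup>=) ^^ k}"
  proof (rule card_mono)
    show "L k \<subseteq> {x. (v, x) \<in> (E\<^sup>=) ^^ k}" using l_walk by (auto simp: L_def)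
    have "{x. (v, x) \<in> (E\<^sup>=) ^^ k} \<subseteq> {v} \<union> Range E"
      using relpow_reflcl_rtrancl by (fastforce elim: rtranclE)
    then show "finite {x. (v, x) \<in> (E\<^sup>=) ^^ k}" using finE by (auto intro: finite_subset finite_Range)
  qed
  finally show ?thesis .
qed

section \<open>Oriented diameter\<close>

text \<open>Edges that \<open>D\<close> leaves undirected point from the smaller to the larger value
  of an injective numbering of \<open>V\<close>.\<close>

lemma total_orientation:
  assumes "finite V" "E \<subseteq> V \<times> V" "irrefl E" "D \<subseteq> E" "D \<inter> D\<inverse> = {}"
  shows "\<exists>D'. D \<subseteq> D' \<and> D' \<subseteq> E \<union> E\<inverse> \<and> (\<forall>(u, v)\<in>E. ((u, v) \<in> D') \<noteq> ((v, u) \<in> D'))"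
proof -
  obtain f :: "'a \<Rightarrow> nat" where f: "inj_on f V"
    using finite_imp_inj_to_nat_seg[OF assms(1)] by blast
  define D' where "D' = D \<union> {(u, v) \<in> E \<union> E\<inverse>. (v, u) \<notin> D \<and> f u < f v}"
  have "((u, v) \<in> D') \<noteq> ((v, u) \<in> D')" if uv: "(u, v) \<in> E" for u v
  proof -
    have "u \<noteq> v" using uv assms(3) by (auto simp: irrefl_def)
    then have "f u \<noteq> f v" using uv assms(2) f by (auto simp: inj_on_def)
    moreover have "\<not> ((u, v) \<in> D \<and> (v, u) \<in> D)" using assms(5) by blast
    ultimately show ?thesis using uv by (cases "(u, v) \<in> D"; cases "(v, u) \<in> D") (auto simp: D'_def)
  qed
  moreover have "D \<subseteq> D'" "D' \<subseteq> E \<union> E\<inverse>" using assms(4) by (auto simp: D'_def)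
  ultimately show ?thesis by (intro exI[of _ D']) auto
qed

lemma (in pair_wf_digraph) relpow_awalk:
  assumes "(x, y) \<in> parcs G ^^ m" "x \<in> pverts G"
  shows "\<exists>p. awalk x p y \<and> length p = m"
  using assms
proof (induction m arbitrary: x)
  case 0
  then show ?case by (intro exI[of _ "[]"]) (simp add: awalk_Nil_iff)
next
  case (Suc m)
  obtain z where z: "(x, z) \<in> parcs G" "(z, y) \<in> parcs G ^^ m"
    using relpow_Suc_D2[OF Suc.prems(1)] by blast
  then obtain p where p: "awalk z p y" "length p = m" using Suc.IH in_arcsD2 by blast
  then have "awalk x ((x, z) # p) y" using z(1) by (simp add: awalk_Cons_iff)
  then show ?case using p(2) by (intro exI[of _ "(x, z) # p"]) simp
qed

text \<open>A shortest walk repeats no vertex, as a closed piece could be cut out.\<close>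

lemma (in pair_wf_digraph) relpow_apath:
  assumes "(x, y) \<in> parcs G ^^ m" "x \<in> pverts G"
  shows "\<exists>p. apath x p y \<and> length p \<le> m"
proof -
  obtain p0 where p0: "awalk x p0 y" "length p0 = m" using relpow_awalk[OF assms] by blast
  obtain p where p: "awalk x p y" and min: "\<And>q. awalk x q y \<Longrightarrow> length p \<le> length q"
    using ex_has_least_nat[of "\<lambda>p. awalk x p y" p0 length] p0(1) by blast
  have "distinct (awalk_verts x p)"
  proof (rule ccontr)
    assume "\<not> distinct (awalk_verts x p)"
    with p obtain q r s where "p = q @ r @ s" "\<exists>w. awalk x q w \<and> awalk w r w \<and> awalk w s y"
      "closed_w r"
      by (rule awalk_cyc_decompE')
    then have "awalk x (q @ s) y" "length (q @ s) < length p"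
      by (auto simp: closed_w_def intro: awalk_appendI)
    then show False using min by (meson not_le)
  qed
  then show ?thesis using p min[OF p0(1)] p0(2) by (auto simp: apath_def)
qed

lemma digraph_dist_le:
  assumes "pair_wf_digraph D" "u \<in> pverts D" "(u, v) \<in> ((parcs D)\<^sup>=) ^^ n"
  shows "digraph_dist D u v \<le> ereal n"
proof -
  interpret pair_wf_digraph D by fact
  obtain m where m: "m \<le> n" "(u, v) \<in> parcs D ^^ m" using assms(3) by (rule relpow_reflclE)
  obtain p where p: "awalk u p v" "length p = m" using relpow_awalk[OF m(2) assms(2)] by blast
  have "\<mu> (\<lambda>_. 1) u v \<le> ereal (awalk_cost (\<lambda>_. 1) p)" by (rule min_cost_le_walk_cost[OF p(1)])
  also have "awalk_cost (\<lambda>_. 1) p = m" using p(2) by (simp add: awalk_cost_def sum_list_triv)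
  finally show ?thesis unfolding digraph_dist_def using m(1) by (auto intro: order_trans)
qed

text \<open>For a symmetric arc set \<open>mk_symmetric\<close> changes nothing, so connectedness,
  defined through the symmetric closure, becomes mutual reachability.\<close>

lemma connected_rtrancl:
  assumes "pair_wf_digraph G" "sym (parcs G)"
  shows "Digraph_Component.connected (with_proj G) \<longleftrightarrow>
    pverts G \<noteq> {} \<and> pverts G \<times> pverts G \<subseteq> (parcs G)\<^sup>*"
proof -
  interpret pair_wf_digraph G by fact
  have "mk_symmetric (with_proj G) = G"
    using assms(2) by (auto simp: mk_symmetric_def sym_def intro!: pair_pre_digraph.equality)
  then show ?thesis
    unfolding connected_def strongly_connected_def by (auto simp: reachable_conv' subset_iff)
qed

lemma out_degree_image:
  "out_degree (with_proj G) v = card (parcs G `` {v})"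
proof -
  have "parcs G `` {v} = snd ` {e \<in> parcs G. fst e = v}" by force
  moreover have "inj_on snd {e \<in> parcs G. fst e = v}" by (auto simp: inj_on_def prod_eq_iff)
  ultimately show ?thesis by (simp add: out_degree_def out_arcs_def card_image)
qed

lemma pair_wf_digraph_delete_edge:
  "pair_wf_digraph G \<Longrightarrow> pair_wf_digraph (delete_edge G e)"
  by (auto simp: pair_wf_digraph_def delete_edge_def)

context pair_graph
begin

lemma sym_parcs: "sym (parcs G)"
  by (auto simp: sym_def intro: arcs_symmetric)

lemma bridgeless_graph_parcs:
  assumes "bridgeless G"
  shows "bridgeless_graph (pverts G) (parcs G)"
proof
  show "finite (pverts G)" by (rule pair_finite_verts)
  show "parcs G \<subseteq> pverts G \<times> pverts G" using in_arcsD1 in_arcsD2 by auto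
  show "sym (parcs G)" by (rule sym_parcs)
  show "irrefl (parcs G)" using no_loops' by (auto simp: irrefl_def)
  show "(x, y) \<in> (parcs G - {(x, y), (y, x)})\<^sup>*" if xy: "(x, y) \<in> parcs G" for x y
  proof -
    have "Digraph_Component.connected (with_proj (delete_edge G (x, y)))"
      using assms xy by (auto simp: bridgeless_def bridge_def)
    moreover have "sym (parcs (delete_edge G (x, y)))"
      using sym_parcs by (auto simp: delete_edge_def sym_def)
    ultimately have "pverts G \<times> pverts G \<subseteq> (parcs G - {(x, y), (y, x)})\<^sup>*"
      using connected_rtrancl[OF pair_wf_digraph_delete_edge[OF pair_wf_digraph], of "(x, y)"]
      by (simp add: delete_edge_def)
    then show ?thesis using in_arcsD1[OF xy] in_arcsD2[OF xy] by blast
  qed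
qed

text \<open>The detour shortens to a path, which the arc \<open>(y, x)\<close> closes to a cycle.
  The path has at least two arcs because the edge is deleted, so the cycle has the length of at
  least 3 required in \<open>girth\<close>.\<close>

lemma girth_le_detour:
  assumes "(y, x) \<in> parcs G" "(x, y) \<in> (parcs G - {(x, y), (y, x)}) ^^ m"
  shows "girth G \<le> enat (Suc m)"
proof -
  define H where "H = delete_edge G (x, y)"
  have arcs_H: "parcs H = parcs G - {(x, y), (y, x)}" and verts_H: "pverts H = pverts G"
    by (simp_all add: H_def delete_edge_def)
  interpret H: pair_wf_digraph H
    unfolding H_def by (rule pair_wf_digraph_delete_edge[OF pair_wf_digraph])
  obtain p where p: "H.apath x p y" "length p \<le> m"
    using H.relpow_apath[of x y m] assms in_arcsD2 by (auto simp: arcs_H verts_H)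
  have walk: "H.awalk x p y" and dist: "distinct (pawalk_verts x p)"
    using p(1) by (simp_all add: H.apath_def)
  have "x \<noteq> y" using no_loops' assms(1) by blast
  then have "p \<noteq> []" using walk by (auto simp: H.awalk_Nil_iff)
  moreover have "p \<noteq> [e]" for e
  proof
    assume "p = [e]"
    then have "H.awalk x [e] y" using walk by simp
    then have "e \<in> parcs H" "x = fst e" "y = snd e" by (simp_all add: H.awalk_simps)
    then show False by (simp add: arcs_H prod_eq_iff)
  qed
  ultimately have "2 \<le> length p" by (cases p rule: remdups_adj.cases) auto
  have "awalk x p y" using walk by (auto simp: H.awalk_def awalk_def arcs_H verts_H)
  then have "awalk y ((y, x) # p) y" using assms(1) by (simp add: awalk_Cons_iff)
  then have "cycle ((y, x) # p)" using dist by (auto simp: cycle_def)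
  then have "girth G \<le> enat (length ((y, x) # p))"
    unfolding girth_def using \<open>2 \<le> length p\<close> by (intro INF_lower) simp
  also have "\<dots> \<le> enat (Suc m)" using p(2) by simp
  finally show ?thesis .
qed

lemma min_degree_le: "v \<in> pverts G \<Longrightarrow> min_degree G \<le> card (parcs G `` {v})"
  unfolding min_degree_def out_degree_image using pair_finite_verts by (intro Min_le) auto

text \<open>A partial orientation suffices: directing the remaining edges only adds arcs and so
  keeps all walks.\<close>

lemma oriented_diameter_le:
  assumes D: "D \<subseteq> parcs G" "D \<inter> D\<inverse> = {}" and "pverts G \<noteq> {}"
    and walks: "\<forall>x\<in>pverts G. \<forall>y\<in>pverts G. (x, y) \<in> (D\<^sup>=) ^^ n"
  shows "oriented_diameter G \<le> ereal n"
proof -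
  have wf: "parcs G \<subseteq> pverts G \<times> pverts G" using in_arcsD1 in_arcsD2 by auto
  have irr: "irrefl (parcs G)" using no_loops' by (auto simp: irrefl_def)
  obtain A where A: "D \<subseteq> A" "A \<subseteq> parcs G \<union> (parcs G)\<inverse>"
    "\<forall>(u, v)\<in>parcs G. ((u, v) \<in> A) \<noteq> ((v, u) \<in> A)"
    using total_orientation[OF pair_finite_verts wf irr D] by (elim exE conjE)
  have A_G: "A \<subseteq> parcs G" using A(2) sym_parcs by (auto simp: sym_def)
  define O' where "O' = \<lparr>pverts = pverts G, parcs = A\<rparr>"
  interpret O': pair_wf_digraph O'
    using A_G in_arcsD1 in_arcsD2 by unfold_locales (auto simp: O'_def)
  have O'_simps: "pverts O' = pverts G" "parcs O' = A" by (simp_all add: O'_def)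
  have walk: "(x, y) \<in> ((parcs O')\<^sup>=) ^^ n" if "x \<in> pverts G" "y \<in> pverts G" for x y
  proof -
    have "(x, y) \<in> (D\<^sup>=) ^^ n" using walks that by blast
    then show ?thesis by (rule relpow_reflcl_mono) (use A(1) in \<open>simp_all add: O'_def\<close>)
  qed
  have "strongly_connected (with_proj O')"
    unfolding strongly_connected_def
    using assms(3) relpow_reflcl_rtrancl[OF walk] by (auto simp: O'_simps O'.reachable_conv')
  moreover have "orientation O' G"
    unfolding orientation_def spanning_def subgraph_def compatible_def
    using A(3) A_G O'.wf_digraph wf_digraph by (auto simp: O'_simps)
  ultimately have "oriented_diameter G \<le> digraph_diameter O'"
    unfolding oriented_diameter_def by (intro INF_lower) simp
  also have "\<dots> \<le> ereal n"
    unfolding digraph_diameter_def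
    using digraph_dist_le[OF O'.pair_wf_digraph_axioms _ walk] by (intro SUP_least) (auto simp: O'_simps)
  finally show ?thesis .
qed

text \<open>Packing: balls of radius \<open>k\<close> around points at distance more than
  \<open>2 * k\<close> are disjoint.\<close>

lemma card_separated_le:
  fixes k :: nat
  assumes "S \<subseteq> pverts G" and sep: "\<forall>s\<in>S. \<forall>t\<in>S. s \<noteq> t \<longrightarrow> (s, t) \<notin> ((parcs G)\<^sup>=) ^^ (2 * k)"
    and ball: "\<And>s. s \<in> S \<Longrightarrow> b \<le> card {x. (s, x) \<in> ((parcs G)\<^sup>=) ^^ k}"
  shows "card S * b \<le> card (pverts G)"
proof -
  define B where "B s = {x. (s, x) \<in> ((parcs G)\<^sup>=) ^^ k}" for s
  have B_sub: "B s \<subseteq> pverts G" if s: "s \<in> S" for s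
  proof
    fix x assume "x \<in> B s"
    then have "(s, x) \<in> (parcs G)\<^sup>*" unfolding B_def mem_Collect_eq by (rule relpow_reflcl_rtrancl)
    then show "x \<in> pverts G" using assms(1) s in_arcsD2 by (cases rule: rtranclE) auto
  qed
  have finB: "finite (B s)" if "s \<in> S" for s
    using B_sub[OF that] pair_finite_verts by (rule finite_subset)
  have finS: "finite S" using assms(1) pair_finite_verts by (rule finite_subset)
  have disj: "B s \<inter> B t = {}" if "s \<in> S" "t \<in> S" "s \<noteq> t" for s t
  proof (rule ccontr)
    assume "B s \<inter> B t \<noteq> {}"
    then obtain x where x: "(s, x) \<in> ((parcs G)\<^sup>=) ^^ k" "(t, x) \<in> ((parcs G)\<^sup>=) ^^ k"
      unfolding B_def by blast
    have "(s, t) \<in> ((parcs G)\<^sup>=) ^^ (k + k)"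
      using x(1) relpow_sym[OF sym_reflcl[OF sym_parcs] x(2)] by (rule relpow_trans)
    then show False using sep that by (simp add: mult_2)
  qed
  have "card S * b \<le> (\<Sum>s\<in>S. card (B s))"
    using sum_mono[of S "\<lambda>_. b" "\<lambda>s. card (B s)"] ball by (simp add: B_def)
  also have "\<dots> = card (\<Union>s\<in>S. B s)"
    using finS finB disj by (intro card_UN_disjoint[symmetric]) auto
  also have "\<dots> \<le> card (pverts G)"
    using B_sub pair_finite_verts by (intro card_mono) auto
  finally show ?thesis .
qed

text \<open>\<open>short_orientation\<close> with \<open>r = 2 * k\<close>, so that the balls of
  radius \<open>k\<close> around \<open>S\<close> are disjoint; \<open>s\<close> is
  \<open>card S\<close>. The maximum with 1 covers minimum degrees at most 1, where
  \<open>(min_degree G - 1) ^ k\<close> may vanish: a ball contains its centre.\<close>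

lemma oriented_diameter_bound:
  fixes g k :: nat
  assumes "Digraph_Component.connected (with_proj G)" "bridgeless G" "girth G = enat g" "2 * k < g"
  obtains s where "s * max 1 ((min_degree G - 1) ^ k) \<le> card (pverts G)"
    "oriented_diameter G \<le> ereal (2 * (2 * k + 1) * (8 * k + 3) * s + 8 * k * (k + 1))"
proof -
  interpret B: bridgeless_graph "pverts G" "parcs G" by (rule bridgeless_graph_parcs) fact
  have conn: "pverts G \<times> pverts G \<subseteq> (parcs G)\<^sup>*" and ne: "pverts G \<noteq> {}"
    using connected_rtrancl[OF pair_wf_digraph sym_parcs] assms(1) by blast+
  obtain S D where S: "S \<subseteq> pverts G"
      "\<forall>s\<in>S. \<forall>t\<in>S. s \<noteq> t \<longrightarrow> (s, t) \<notin> ((parcs G)\<^sup>=) ^^ (2 * k)"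
    and D: "D \<subseteq> parcs G" "D \<inter> D\<inverse> = {}" "\<forall>x\<in>pverts G. \<forall>y\<in>pverts G.
      (x, y) \<in> (D\<^sup>=) ^^ (2 * (2 * k + 1) * (4 * (2 * k) + 3) * card S + 2 * (2 * k * (2 * k + 2)))"
    using B.short_orientation[OF conn ne, of "2 * k"] by (elim exE conjE)
  \<comment> \<open>A detour of length \<open>m\<close> gives \<open>g \<le> m + 1\<close>, and
    \<open>2 * k < g\<close> absorbs the extra 1.\<close>
  have cycles: "2 * k \<le> m"
    if "(y, x) \<in> parcs G" "(x, y) \<in> (parcs G - {(x, y), (y, x)}) ^^ m" for x y m
    using girth_le_detour[OF that] assms(3,4) by simp
  have ball: "max 1 ((min_degree G - 1) ^ k) \<le> card {x. (s, x) \<in> ((parcs G)\<^sup>=) ^^ k}"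
    if s: "s \<in> S" for s
  proof -
    let ?B = "{x. (s, x) \<in> ((parcs G)\<^sup>=) ^^ k}"
    have sV: "s \<in> pverts G" using s S(1) by blast
    have "?B \<subseteq> insert s (Range (parcs G))"
    proof
      fix x assume "x \<in> ?B"
      then have "(s, x) \<in> (parcs G)\<^sup>*" unfolding mem_Collect_eq by (rule relpow_reflcl_rtrancl)
      then show "x \<in> insert s (Range (parcs G))" by (cases rule: rtranclE) auto
    qed
    then have "finite ?B"
      by (rule finite_subset) (simp add: pair_finite_arcs finite_Range)
    moreover have "s \<in> ?B"
      unfolding mem_Collect_eq by (rule relpow_reflcl_mono[of s s 0 "parcs G"]) simp_all
    ultimately have "1 \<le> card ?B" by (metis One_nat_def Suc_leI card_gt_0_iff empty_iff)
    moreover have "(min_degree G - 1) ^ k \<le> card ?B"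
      by (rule ball_size[OF B.finite_V B.E_subset B.sym_E min_degree_le cycles sV])
    ultimately show ?thesis by (rule max.boundedI)
  qed
  have "oriented_diameter G \<le>
      ereal (real (2 * (2 * k + 1) * (4 * (2 * k) + 3) * card S + 2 * (2 * k * (2 * k + 2))))"
    using D(1,2) ne D(3) by (rule oriented_diameter_le)
  also have "real (2 * (2 * k + 1) * (4 * (2 * k) + 3) * card S + 2 * (2 * k * (2 * k + 2))) =
      2 * (2 * k + 1) * (8 * k + 3) * card S + 8 * k * (k + 1)"
    by (simp add: algebra_simps)
  finally show thesis using card_separated_le[OF S ball] by (intro that)
qed

end

theorem theorem1p1:
  fixes g :: nat
  assumes "g \<ge> 3"
  shows "\<exists>h :: real poly. degree h = (g - 1) div 2 \<and>
    (\<forall>\<epsilon> :: real. \<epsilon> > 0 \<longrightarrow> (\<exists>c :: real.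
      \<forall>(G :: 'a pair_pre_digraph) (n :: nat) (\<delta> :: nat).
        pair_graph G \<and> Digraph_Component.connected (with_proj G) \<and> bridgeless G \<and>
        card (pverts G) = n \<and> min_degree G = \<delta> \<and> girth G = enat g \<longrightarrow>
        oriented_diameter G
          \<le> ereal ((2 * real g + \<epsilon>) * (real n / poly h (real \<delta>)) + c)))"
proof -
  define k where "k = (g - 1) div 2"
  have k: "k \<ge> 1" "2 * k < g" using assms by (auto simp: k_def)
  \<comment> \<open>The coefficient of \<open>s\<close> in
    \<open>oriented_diameter_bound\<close>.\<close>
  define K :: real where "K = 2 * (2 * k + 1) * (8 * k + 3)"
  have "K > 0" unfolding K_def of_nat_0_less_iff by simp
  \<comment> \<open>The summand 1 keeps \<open>h\<close> positive at 0.\<close>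
  define h :: "real poly" where "h = smult (1 / (K * 2 ^ (k + 1))) (monom 1 k + 1)"
  have "degree (monom 1 k + 1 :: real poly) = k"
    using k(1) by (subst degree_add_eq_left) (simp_all add: degree_monom_eq)
  then have "degree h = k" using \<open>K > 0\<close> by (simp add: h_def)
  also note k_def
  finally have deg: "degree h = (g - 1) div 2" .
  have bound: "oriented_diameter G
      \<le> ereal ((2 * real g + \<epsilon>) * (real n / poly h (real \<delta>)) + 8 * k * (k + 1))"
    if "\<epsilon> > 0" and G: "pair_graph G" "Digraph_Component.connected (with_proj G)" "bridgeless G"
      "card (pverts G) = n" "min_degree G = \<delta>" "girth G = enat g"
    for \<epsilon> :: real and G :: "'a pair_pre_digraph" and n \<delta> :: nat
  proof -
    obtain s where s: "s * max 1 ((\<delta> - 1) ^ k) \<le> n"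
      and diam: "oriented_diameter G \<le> ereal (2 * (2 * k + 1) * (8 * k + 3) * s + 8 * k * (k + 1))"
      using pair_graph.oriented_diameter_bound[OF G(1-3,6) k(2)] G(4,5) by metis
    have hd: "poly h (real \<delta>) = (real \<delta> ^ k + 1) / (K * 2 ^ (k + 1))"
      by (simp add: h_def poly_monom)
    have hpos: "poly h (real \<delta>) > 0" unfolding hd using \<open>K > 0\<close> by (simp add: add_nonneg_pos)
    \<comment> \<open>The factor \<open>2 ^ k\<close> comes from
      \<open>\<delta> \<le> 2 * (\<delta> - 1)\<close> for \<open>\<delta> \<ge> 2\<close>; the last
      factor 2 pays for the summand 1.\<close>
    have "\<delta> ^ k + 1 \<le> 2 ^ (k + 1) * max 1 ((\<delta> - 1) ^ k)"
    proof (cases "\<delta> \<ge> 2")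
      case True
      then have "\<delta> ^ k \<le> (2 * (\<delta> - 1)) ^ k" by (intro power_mono) auto
      also have "\<dots> = 2 ^ k * (\<delta> - 1) ^ k" by (rule power_mult_distrib)
      also have "\<dots> \<le> 2 ^ k * max 1 ((\<delta> - 1) ^ k)" by (intro mult_le_mono2) simp
      finally have "\<delta> ^ k \<le> 2 ^ k * max 1 ((\<delta> - 1) ^ k)" .
      moreover have "1 \<le> 2 ^ k * max 1 ((\<delta> - 1) ^ k)" by simp
      ultimately have "\<delta> ^ k + 1 \<le> 2 ^ k * max 1 ((\<delta> - 1) ^ k) + 2 ^ k * max 1 ((\<delta> - 1) ^ k)"
        by (rule add_mono)
      then show ?thesis by simp
    next
      case False
      then have "\<delta> ^ k \<le> 1" by (intro power_le_one) auto
      then have "\<delta> ^ k + 1 \<le> 2 * 1" by simp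
      also have "\<dots> \<le> 2 ^ (k + 1) * max 1 ((\<delta> - 1) ^ k)" by (intro mult_le_mono) simp_all
      finally show ?thesis .
    qed
    then have "s * (\<delta> ^ k + 1) \<le> s * (2 ^ (k + 1) * max 1 ((\<delta> - 1) ^ k))" by (rule mult_le_mono2)
    also have "\<dots> = 2 ^ (k + 1) * (s * max 1 ((\<delta> - 1) ^ k))" by simp
    also have "\<dots> \<le> 2 ^ (k + 1) * n" using s by (rule mult_le_mono2)
    finally have "real (s * (\<delta> ^ k + 1)) \<le> real (2 ^ (k + 1) * n)" by (rule of_nat_mono)
    then have "real s * (real \<delta> ^ k + 1) \<le> 2 ^ (k + 1) * real n" by (simp add: algebra_simps)
    then have "K * (real s * (real \<delta> ^ k + 1)) \<le> K * (2 ^ (k + 1) * real n)"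
      using \<open>K > 0\<close> by (intro mult_left_mono) auto
    then have "K * s \<le> real n / poly h (real \<delta>)"
      unfolding hd using \<open>K > 0\<close> by (simp add: pos_le_divide_eq add_nonneg_pos mult_ac)
    \<comment> \<open>As \<open>2 * real g + \<epsilon>\<close> is at least 1, this factor may be
      inserted; the true constant \<open>K\<close> is absorbed in \<open>h\<close>.\<close>
    also have "\<dots> \<le> (2 * real g + \<epsilon>) * (real n / poly h (real \<delta>))"
      using mult_right_mono[of 1 "2 * real g + \<epsilon>" "real n / poly h (real \<delta>)"] \<open>\<epsilon> > 0\<close> assms hpos
      by simp
    finally have "K * s + 8 * k * (k + 1) \<le>
        (2 * real g + \<epsilon>) * (real n / poly h (real \<delta>)) + 8 * k * (k + 1)" by simp
    then show ?thesis
      unfolding K_def by (intro order_trans[OF diam]) simp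
  qed
  show ?thesis
    \<comment> \<open>The additive constant depends on \<open>g\<close> only, through
      \<open>k\<close>.\<close>
    by (intro exI[of _ h] conjI deg allI impI exI[of _ "real (8 * k * (k + 1))"])
      (elim conjE, rule bound)
qed

end
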